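(* Assume $0<\rho_b<\rho_h$ and $\rho_b+\rho_h\le1$, and $p\in[0,1]$. For the golf process on $\mathbb{Z}$ with these parameters, for every integer $\ell_0\ge0$, $$\mathbb{P}(\Delta_0H^1=\ell_0)=(\rho_h-\rho_b)\sum_{b_0:\,2b_0\le\ell_0}\frac{\ell_0+1}{b_0+1}\binom{\ell_0}{b_0,\,b_0,\,\ell_0-2b_0}\rho_b^{b_0}\rho_h^{b_0+1}(1-\rho_b-\rho_h)^{\ell_0-2b_0}.$$
   Context: Golf process on $\mathbb{Z}$: initial states i.i.d., ball with probability $\rho_b$, hole with probability $\rho_h$, neutral otherwise; clocks i.i.d. uniform on $[0,1]$; at its clock time each ball performs an independent random walk (step $+1$ w.p. $p$, $-1$ w.p. $1-p$) from its vertex, stopped at the first currently free hole, which it fills. $H^1$ is the set of holes free at time $1$ (a.s. infinite in both directions under the hypotheses); $H^1_0$ is its largest nonpositive element, $H^1_1$ its smallest positive element, and $\Delta_0H^1=H^1_1-H^1_0-1$. *)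

theory Defs
  imports "HOL-Probability.Probability"
begin

datatype site_state = Ball | Hole | Neutral

text \<open>Data attached to a vertex: initial state, clock, and the step sequence of the
  random walk that a ball started at that vertex performs (True = step +1,
  False = step -1).\<close>
type_synonym site = "site_state \<times> real \<times> (nat \<Rightarrow> bool)"

definition state_pmf :: "real \<Rightarrow> real \<Rightarrow> site_state pmf" where
  "state_pmf rb rh = pmf_of_list [(Ball, rb), (Hole, rh), (Neutral, 1 - rb - rh)]"

definition walk_measure :: "real \<Rightarrow> (nat \<Rightarrow> bool) measure" where
  "walk_measure p = PiM UNIV (\<lambda>_::nat. measure_pmf (bernoulli_pmf p))"

definition site_measure :: "real \<Rightarrow> real \<Rightarrow> real \<Rightarrow> site measure" where
  "site_measure p rb rh =
     measure_pmf (state_pmf rb rh) \<Otimes>\<^sub>M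
       (uniform_measure lborel {0..1::real} \<Otimes>\<^sub>M walk_measure p)"

definition golf_space :: "real \<Rightarrow> real \<Rightarrow> real \<Rightarrow> (int \<Rightarrow> site) measure" where
  "golf_space p rb rh = PiM UNIV (\<lambda>_::int. site_measure p rb rh)"

definition st :: "(int \<Rightarrow> site) \<Rightarrow> int \<Rightarrow> site_state" where
  "st \<omega> x = fst (\<omega> x)"

definition clock :: "(int \<Rightarrow> site) \<Rightarrow> int \<Rightarrow> real" where
  "clock \<omega> x = fst (snd (\<omega> x))"

definition steps :: "(int \<Rightarrow> site) \<Rightarrow> int \<Rightarrow> nat \<Rightarrow> bool" where
  "steps \<omega> x = snd (snd (\<omega> x))"

definition walk :: "(int \<Rightarrow> site) \<Rightarrow> int \<Rightarrow> nat \<Rightarrow> int" where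
  "walk \<omega> x k = x + (\<Sum>i<k. if steps \<omega> x i then 1 else -1)"

definition ball_move :: "(int \<Rightarrow> site) \<Rightarrow> int set \<Rightarrow> int \<Rightarrow> int set" where
  "ball_move \<omega> F x =
     (if \<exists>k. walk \<omega> x k \<in> F
      then F - {walk \<omega> x (LEAST k. walk \<omega> x k \<in> F)} else F)"

text \<open>Finite-volume process on the window [-n,n] (everything outside treated as
  neutral): balls fire in increasing order of their clocks (ties, a null event,
  broken by position); the result is the set of holes free at time 1.\<close>
definition free_fin :: "nat \<Rightarrow> (int \<Rightarrow> site) \<Rightarrow> int set" where
  "free_fin n \<omega> =
     foldl (ball_move \<omega>)
       {x \<in> {- int n..int n}. st \<omega> x = Hole}
       (sort_key (clock \<omega>)
          (filter (\<lambda>x. st \<omega> x = Ball \<and> clock \<omega> x \<le> 1) [- int n..int n]))"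

text \<open>H^1: holes free at time 1 for the process on Z, obtained as the
  (eventually stable) infinite-volume limit of the finite-volume processes.\<close>
definition H1 :: "(int \<Rightarrow> site) \<Rightarrow> int set" where
  "H1 \<omega> = {y. \<forall>\<^sub>F n in sequentially. y \<in> free_fin n \<omega>}"

text \<open>The event Delta_0 H^1 = l: H^1_0 = a (largest nonpositive element),
  H^1_1 = b (smallest positive element), b - a - 1 = l.\<close>
definition gap0_eq :: "(int \<Rightarrow> site) \<Rightarrow> int \<Rightarrow> bool" where
  "gap0_eq \<omega> l \<longleftrightarrow>
     (\<exists>a b. a \<le> 0 \<and> 0 < b \<and> a \<in> H1 \<omega> \<and> b \<in> H1 \<omega> \<and>
            (\<forall>y. a < y \<and> y < b \<longrightarrow> y \<notin> H1 \<omega>) \<and> b - a - 1 = l)"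

end

theory Submission
  imports Defs
begin

text \<open>A hole with at least as many holes as balls in every interval ending next to it is never
  touched (a barrier). Since \<open>rb < rh\<close>, almost surely there are barriers arbitrarily far away on
  both sides, and between two of them the process does not depend on the window. Hence the
  probability that \<open>a < b\<close> are consecutive free holes is a constant times the probability that an
  interval of length \<open>l = b - a - 1\<close> between two holes fills up without a ball leaving it. Gluing the
  two holes together turns this interval into a circle of \<open>l + 1\<close> sites on which exactly one hole
  stays free; by rotation invariance that hole is uniform, so the probability is \<open>1 / (l + 1)\<close> times
  the probability that \<open>l + 1\<close> sites carry one hole more than balls. Summing over the \<open>l + 1\<close>
  positions of the gap around 0, the law of the gap is proportional to the probability that a lazy
  random walk with drift \<open>rh - rb\<close> is at 1 after \<open>l + 1\<close> steps. The expected number of visits of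
  this walk to 1 is \<open>1 / (rh - rb)\<close>, which determines the constant.\<close>

section \<open>Successive moves of balls\<close>

text \<open>A ball may travel arbitrarily far, so the firing order couples distant sites. All
  control comes from one observation: a nearest-neighbour walk cannot pass a free hole without
  filling it. As long as a hole stays free, its two sides evolve separately, and only the order of
  the clocks within each side matters. This factorises the event of two consecutive free holes
  exactly in every finite window. Barriers depend on the initial states alone and carry the
  factorisation to the limit. On the line the walks may be transient, and \<open>p\<close> may be 0
  or 1. On a circle every walk almost surely visits every site, because long runs of equal steps
  occur; hence the number of holes left there is determined by the initial states. This is where
  \<open>p\<close> drops out of the answer. The factors that come from outside the gap are never
  computed: only the limit of their product matters, and it is fixed by the fact that the gap law
  sums to 1. Moves are defined for an arbitrary family of position functions, so that the line, its
  mirror image and the circle share one set of lemmas.\<close>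

definition move :: "(int \<Rightarrow> nat \<Rightarrow> int) \<Rightarrow> int set \<Rightarrow> int \<Rightarrow> int set" where
  "move w F x = (if \<exists>k. w x k \<in> F then F - {w x (LEAST k. w x k \<in> F)} else F)"

abbreviation run :: "(int \<Rightarrow> nat \<Rightarrow> int) \<Rightarrow> int set \<Rightarrow> int list \<Rightarrow> int set" where
  "run w \<equiv> foldl (move w)"

definition nearest_neighbour :: "(int \<Rightarrow> nat \<Rightarrow> int) \<Rightarrow> bool" where
  "nearest_neighbour w \<longleftrightarrow> (\<forall>x. w x 0 = x \<and> (\<forall>k. \<bar>w x (Suc k) - w x k\<bar> \<le> 1))"

lemma move_first_hit:
  assumes "w x k \<in> F" "\<And>j. j < k \<Longrightarrow> w x j \<notin> F"
  shows "move w F x = F - {w x k}"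
proof -
  have "(LEAST k. w x k \<in> F) = k"
    using assms by (intro Least_equality) (auto simp: not_le[symmetric])
  then show ?thesis using assms(1) by (auto simp: move_def)
qed

lemma move_no_hit: "(\<And>k. w x k \<notin> F) \<Longrightarrow> move w F x = F"
  by (auto simp: move_def)

lemma first_hit_cases:
  fixes w :: "int \<Rightarrow> nat \<Rightarrow> int"
  obtains (none) "\<And>k. w x k \<notin> F"
  | (hit) k where "w x k \<in> F" "\<And>j. j < k \<Longrightarrow> w x j \<notin> F"
proof (cases "\<exists>k. w x k \<in> F")
  case True
  show ?thesis
  proof (rule hit)
    show "w x (LEAST k. w x k \<in> F) \<in> F" using LeastI_ex[of "\<lambda>k. w x k \<in> F"] True by simp
    show "w x j \<notin> F" if "j < (LEAST k. w x k \<in> F)" for j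
      using not_less_Least[of j "\<lambda>k. w x k \<in> F"] that by simp
  qed
next
  case False
  then show ?thesis using none by blast
qed

lemma move_subset: "move w F x \<subseteq> F"
  by (auto simp: move_def)

lemma run_subset: "run w F L \<subseteq> F"
proof (induction L arbitrary: F)
  case (Cons x L)
  show ?case using Cons.IH[of "move w F x"] move_subset[of w F x] by simp
qed simp

section \<open>Cutting the dynamics at a free hole\<close>

lemma nearest_neighbour_between:
  assumes "nearest_neighbour w" "x \<le> c \<and> c \<le> w x k \<or> w x k \<le> c \<and> c \<le> x"
  shows "\<exists>j\<le>k. w x j = c"
  using assms(2)
proof (induction k)
  case 0
  then show ?case using assms(1) by (auto simp: nearest_neighbour_def)
next
  case (Suc k)
  have "\<bar>w x (Suc k) - w x k\<bar> \<le> 1"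
    using assms(1) by (auto simp: nearest_neighbour_def)
  then consider "x \<le> c \<and> c \<le> w x k \<or> w x k \<le> c \<and> c \<le> x" | "w x (Suc k) = c"
    using Suc.prems by linarith
  then show ?case
  proof cases
    case 1
    from Suc.IH[OF this] show ?thesis using le_SucI by blast
  next
    case 2
    then show ?thesis by blast
  qed
qed

text \<open>A move changes the set of free holes only at the point of first hit. If that point is
  sure to lie in \<open>A\<close>, the holes outside \<open>A\<close> neither influence the move nor
  are affected by it. Used with \<open>A\<close> a half-line ending at a free hole.\<close>

lemma move_Int:
  assumes "\<And>k. w x k \<in> F \<Longrightarrow> (\<And>j. j < k \<Longrightarrow> w x j \<notin> F) \<Longrightarrow> w x k \<in> A"
  shows "move w (F \<inter> A) x = move w F x \<inter> A" "move w F x - A = F - A"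
proof -
  have "move w (F \<inter> A) x = move w F x \<inter> A \<and> move w F x - A = F - A"
  proof (cases w x F rule: first_hit_cases)
    case none
    then show ?thesis by (simp add: move_no_hit)
  next
    case (hit k)
    then have "w x k \<in> A" using assms by blast
    then have "move w F x = F - {w x k}" "move w (F \<inter> A) x = F \<inter> A - {w x k}"
      using hit by (auto intro!: move_first_hit)
    then show ?thesis using \<open>w x k \<in> A\<close> by auto
  qed
  then show "move w (F \<inter> A) x = move w F x \<inter> A" "move w F x - A = F - A" by auto
qed

lemma move_below:
  assumes "nearest_neighbour w" "c \<in> F" "x < c"
  shows "move w (F \<inter> {..c}) x = move w F x \<inter> {..c}" "move w F x - {..c} = F - {..c}"
proof -
  have "w x k \<in> {..c}" if "w x k \<in> F" "\<And>j. j < k \<Longrightarrow> w x j \<notin> F" for k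
    using nearest_neighbour_between[OF assms(1), of x c k] that assms
    by (metis atMost_iff linorder_le_cases nless_le)
  then show "move w (F \<inter> {..c}) x = move w F x \<inter> {..c}" "move w F x - {..c} = F - {..c}"
    using move_Int[of w x F "{..c}"] by blast+
qed

lemma move_above:
  assumes "nearest_neighbour w" "c \<in> F" "c < x"
  shows "move w (F \<inter> {c..}) x = move w F x \<inter> {c..}" "move w F x - {c..} = F - {c..}"
proof -
  have "w x k \<in> {c..}" if "w x k \<in> F" "\<And>j. j < k \<Longrightarrow> w x j \<notin> F" for k
    using nearest_neighbour_between[OF assms(1), of x c k] that assms
    by (metis atLeast_iff linorder_le_cases nless_le)
  then show "move w (F \<inter> {c..}) x = move w F x \<inter> {c..}" "move w F x - {c..} = F - {c..}"
    using move_Int[of w x F "{c..}"] by blast+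
qed

text \<open>While \<open>c\<close> is free, a ball starting on one side of it stops at
  \<open>c\<close> at the latest, so it acts on its own half only; both halves contain
  \<open>c\<close> as their end. Once \<open>c\<close> is filled in one half it is gone for good,
  because runs only shrink, and both sides of the equivalence are false. The order of firing between
  the two sides never enters, which is the source of the independence used later.\<close>

lemma run_cut:
  assumes "nearest_neighbour w" "c \<in> F" "c \<notin> set L"
  defines "l \<equiv> run w (F \<inter> {..c}) (filter (\<lambda>x. x < c) L)"
    and "r \<equiv> run w (F \<inter> {c..}) (filter (\<lambda>x. c < x) L)"
  shows "(c \<in> run w F L \<longleftrightarrow> c \<in> l \<and> c \<in> r) \<and> (c \<in> run w F L \<longrightarrow> run w F L = l \<union> r)"
  using assms(2,3) unfolding l_def r_def
proof (induction L arbitrary: F)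
  case Nil
  then show ?case by auto
next
  case (Cons x L)
  define F' where "F' = move w F x"
  consider "x < c" | "c < x" using Cons.prems by fastforce
  then show ?case
  proof cases
    case 1
    have eq: "move w (F \<inter> {..c}) x = F' \<inter> {..c}" "F' - {..c} = F - {..c}"
      using move_below[OF assms(1) Cons.prems(1) 1] by (auto simp: F'_def)
    show ?thesis
    proof (cases "c \<in> F'")
      case True
      have "F' \<inter> {c..} = F \<inter> {c..}"
      proof -
        have "y \<in> F' \<longleftrightarrow> y \<in> F" if "c \<le> y" for y
        proof (cases "y = c")
          case False
          then have "y \<notin> {..c}" using that by auto
          then show ?thesis using eq(2) by blast
        qed (use True Cons.prems in simp)
        then show ?thesis by auto
      qed
      then show ?thesis using Cons.IH[of F'] True Cons.prems 1 eq(1)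
        by (simp add: F'_def)
    next
      case False
      then have "c \<notin> run w F' L" "c \<notin> run w (F' \<inter> {..c}) (filter (\<lambda>x. x < c) L)"
        using run_subset by blast+
      then show ?thesis using 1 eq(1) by (simp add: F'_def)
    qed
  next
    case 2
    have eq: "move w (F \<inter> {c..}) x = F' \<inter> {c..}" "F' - {c..} = F - {c..}"
      using move_above[OF assms(1) Cons.prems(1) 2] by (auto simp: F'_def)
    show ?thesis
    proof (cases "c \<in> F'")
      case True
      have "F' \<inter> {..c} = F \<inter> {..c}"
      proof -
        have "y \<in> F' \<longleftrightarrow> y \<in> F" if "y \<le> c" for y
        proof (cases "y = c")
          case False
          then have "y \<notin> {c..}" using that by auto
          then show ?thesis using eq(2) by blast
        qed (use True Cons.prems in simp)
        then show ?thesis by auto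
      qed
      then show ?thesis using Cons.IH[of F'] True Cons.prems 2 eq(1)
        by (simp add: F'_def)
    next
      case False
      then have "c \<notin> run w F' L" "c \<notin> run w (F' \<inter> {c..}) (filter (\<lambda>x. c < x) L)"
        using run_subset by blast+
      then show ?thesis using 2 eq(1) by (simp add: F'_def)
    qed
  qed
qed

section \<open>Conjugated dynamics and the number of holes filled\<close>

lemma move_conj:
  assumes "inj \<pi>" "\<And>k. v (\<pi> x) k = \<pi> (v' x k)"
  shows "move v (\<pi> ` F) (\<pi> x) = \<pi> ` move v' F x"
proof -
  have "v (\<pi> x) k \<in> \<pi> ` F \<longleftrightarrow> v' x k \<in> F" for k
    using assms by (auto dest: injD)
  then show ?thesis using assms
    by (auto simp: move_def dest: injD)
qed

text \<open>Applied to the reflection and the translations of the line and to the rotations of the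
  circle. The commutation is required only at the balls in \<open>L\<close>, because a rotation is
  compatible with the walks only at sites of the circle.\<close>

lemma run_conj:
  assumes "inj \<pi>" "\<And>x k. x \<in> set L \<Longrightarrow> v (\<pi> x) k = \<pi> (v' x k)"
  shows "run v (\<pi> ` F) (map \<pi> L) = \<pi> ` run v' F L"
  using assms(2)
proof (induction L arbitrary: F)
  case (Cons x L)
  have "move v (\<pi> ` F) (\<pi> x) = \<pi> ` move v' F x"
    using Cons.prems by (intro move_conj[OF assms(1)]) simp
  then show ?case using Cons.IH[of "move v' F x"] Cons.prems by simp
qed simp

text \<open>Every ball fills a hole as long as one is left. The truncated subtraction is intended:
  balls that find no free hole change nothing.\<close>

lemma card_run:
  assumes "finite F" "\<And>x y. x \<in> set L \<Longrightarrow> y \<in> F \<Longrightarrow> \<exists>k. v x k = y"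
  shows "card (run v F L) = card F - length L"
  using assms
proof (induction L arbitrary: F)
  case (Cons x L)
  show ?case
  proof (cases "F = {}")
    case True
    have "run v F (x # L) \<subseteq> F" by (rule run_subset)
    then have "run v F (x # L) = {}" using True by blast
    then show ?thesis using True by (simp only: card.empty)
  next
    case False
    then obtain z where "z \<in> F" by blast
    then obtain k where "v x k \<in> F" using Cons.prems(2)[of x z] by force
    then obtain y where y: "y \<in> F" "move v F x = F - {y}"
      using move_first_hit[of v x _ F] by (cases v x F rule: first_hit_cases) blast+
    have "card (run v (F - {y}) L) = card (F - {y}) - length L"
    proof (rule Cons.IH)
      show "\<exists>k. v x' k = y'" if "x' \<in> set L" "y' \<in> F - {y}" for x' y'
        using that by (intro Cons.prems(2)) simp_all
    qed (use Cons.prems(1) in simp)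
    moreover have "card (F - {y}) = card F - 1" using y(1) by (rule card_Diff_singleton)
    ultimately show ?thesis using y(2) by (simp only: foldl_Cons list.size)
  qed
qed simp

text \<open>The ball-counting hypothesis is preserved by each move: a ball released in \<open>[d, c)\<close> that
  leaves \<open>[d, c)\<close> on its right would have to pass a free hole of \<open>[x, c)\<close>.\<close>
lemma run_untouched_from_left:
  assumes "nearest_neighbour w" "finite F" "c \<in> F" "set L \<subseteq> {..<c}"
    and "\<And>d. length (filter (\<lambda>x. d \<le> x) L) \<le> card (F \<inter> {d..<c})"
  shows "c \<in> run w F L"
  using assms(2-)
proof (induction L arbitrary: F)
  case (Cons x L)
  have xc: "x < c" using Cons.prems by auto
  have len: "length (filter ((\<le>) d) L) + (if d \<le> x then 1 else 0) \<le> card (F \<inter> {d..<c})" for d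
    using Cons.prems(4)[of d] by (cases "d \<le> x") auto
  have "c \<in> run w (move w F x) L"
  proof (cases w x F rule: first_hit_cases)
    case none
    then have "move w F x = F" by (rule move_no_hit)
    moreover have "c \<in> run w F L"
    proof (rule Cons.IH)
      show "length (filter ((\<le>) d) L) \<le> card (F \<inter> {d..<c})" for d
        using len[of d] by linarith
    qed (use Cons.prems in auto)
    ultimately show ?thesis by metis
  next
    case (hit k)
    define h where "h = w x k"
    have "card (F \<inter> {x..<c}) \<noteq> 0" using len[of x] by auto
    then obtain y where y: "y \<in> F" "x \<le> y" "y < c"
      by (metis Int_iff atLeastLessThan_iff card.empty ex_in_conv)
    have h: "h \<in> F" "h \<le> y"
    proof -
      show "h \<le> y"
      proof (rule ccontr)
        assume "\<not> h \<le> y"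
        then obtain j where "j \<le> k" "w x j = y"
          using nearest_neighbour_between[OF assms(1), of x y k] y h_def by auto
        then show False using hit y h_def \<open>\<not> h \<le> y\<close> by (cases "j = k") auto
      qed
    qed (use hit h_def in auto)
    have "c \<in> run w (F - {h}) L"
    proof (rule Cons.IH)
      fix d
      show "length (filter ((\<le>) d) L) \<le> card ((F - {h}) \<inter> {d..<c})"
      proof (cases "d \<le> h")
        case False
        then have "(F - {h}) \<inter> {d..<c} = F \<inter> {d..<c}" by auto
        then show ?thesis using len[of d] by simp
      next
        case True
        have *: "(F - {h}) \<inter> {d..<c} = F \<inter> {d..<c} - {h}" by auto
        have c1: "card ((F - {h}) \<inter> {d..<c}) = card (F \<inter> {d..<c}) - 1"
          using True h y Cons.prems(1) unfolding * by (subst card_Diff_singleton) auto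
        show ?thesis
        proof (cases "d \<le> x")
          case True
          then show ?thesis using len[of d] c1 by simp
        next
          case False
          \<comment> \<open>The ball starts before \<open>d\<close> but its first hit
            \<open>h\<close> lies at or beyond \<open>d\<close>, so no free hole lies in
            \<open>[x, d)\<close>. The bound at \<open>x\<close>, which counts the ball
            \<open>x\<close> itself, therefore carries over to \<open>d\<close> with the one unit to
            spare that the removal of \<open>h\<close> costs.\<close>
          have "F \<inter> {x..<c} \<subseteq> F \<inter> {d..<c}"
          proof
            fix z assume z: "z \<in> F \<inter> {x..<c}"
            have "\<not> z < h"
            proof
              assume "z < h"
              then obtain j where "j \<le> k" "w x j = z"
                using nearest_neighbour_between[OF assms(1), of x z k] z h_def by auto
              then show False using hit z h_def \<open>z < h\<close> by (cases "j = k") auto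
            qed
            then show "z \<in> F \<inter> {d..<c}" using z True by auto
          qed
          then have "card (F \<inter> {x..<c}) \<le> card (F \<inter> {d..<c})"
            using Cons.prems(1) by (intro card_mono) auto
          moreover have "length (filter ((\<le>) d) L) \<le> length (filter ((\<le>) x) L)"
            using False by (induction L) auto
          ultimately show ?thesis using len[of x] c1 by simp
        qed
      qed
    qed (use Cons.prems h y in auto)
    then show ?thesis using move_first_hit[of w x k F, OF hit] h_def by simp
  qed
  then show ?case by simp
qed simp

lemma run_untouched_from_right:
  assumes "nearest_neighbour w" "finite F" "c \<in> F" "set L \<subseteq> {c<..}"
    and "\<And>d. length (filter (\<lambda>x. x \<le> d) L) \<le> card (F \<inter> {c<..d})"
  shows "c \<in> run w F L"
proof -
  define w' where "w' x k = - w (- x) k" for x k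
  have "- c \<in> run w' (uminus ` F) (map uminus L)"
  proof (rule run_untouched_from_left)
    show "nearest_neighbour w'"
      unfolding nearest_neighbour_def
    proof (intro allI conjI)
      fix x k
      show "w' x 0 = x" using assms(1) by (auto simp: nearest_neighbour_def w'_def)
      have "\<bar>w (- x) (Suc k) - w (- x) k\<bar> \<le> 1" using assms(1) by (auto simp: nearest_neighbour_def)
      then show "\<bar>w' x (Suc k) - w' x k\<bar> \<le> 1" by (simp add: w'_def)
    qed
    show "length (filter ((\<le>) d) (map uminus L)) \<le> card (uminus ` F \<inter> {d..<- c})" for d
    proof -
      have "uminus ` F \<inter> {d..<- c} = uminus ` (F \<inter> {c<..- d})" by force
      then have "card (uminus ` F \<inter> {d..<- c}) = card (F \<inter> {c<..- d})"
        by (simp add: card_image inj_on_def)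
      moreover have "filter ((\<le>) d) (map uminus L) = map uminus (filter (\<lambda>x. x \<le> - d) L)"
        by (simp add: filter_map o_def le_minus_iff)
      ultimately show ?thesis using assms(5)[of "- d"] by simp
    qed
  qed (use assms in auto)
  also have "run w' (uminus ` F) (map uminus L) = uminus ` run w F L"
    by (rule run_conj) (auto simp: w'_def)
  finally show ?thesis by auto
qed

text \<open>Unrolling the circle at the hole 0: the two ends 0 and \<open>M\<close> of the interval both represent
  that hole.\<close>
lemma run_circle:
  assumes "nearest_neighbour w" "0 < M" "F \<subseteq> {0<..<M}" "set L \<subseteq> {0<..<M}"
  defines "v \<equiv> \<lambda>x k. w x k mod M"
  shows "(0 \<in> run v (insert 0 F) L \<longleftrightarrow> 0 \<in> run w (insert 0 (insert M F)) L \<and> M \<in> run w (insert 0 (insert M F)) L)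
    \<and> (0 \<in> run v (insert 0 F) L \<longrightarrow> run w (insert 0 (insert M F)) L = insert M (run v (insert 0 F) L))"
  using assms(3,4)
proof (induction L arbitrary: F)
  case Nil
  then show ?case by auto
next
  case (Cons x L)
  let ?C = "insert 0 F" and ?I = "insert 0 (insert M F)"
  have x: "0 < x" "x < M" using Cons.prems by auto
  \<comment> \<open>Both ends are free holes of the interval, so before the first hit the walk stays
    between them; there the interval and the circle agree up to identifying \<open>M\<close> with
    0.\<close>
  have inI: "0 \<le> w x k \<and> w x k \<le> M" if "\<And>j. j < k \<Longrightarrow> w x j \<notin> ?I" for k
  proof (rule ccontr)
    assume a: "\<not> ?thesis"
    then obtain c where "c = 0 \<or> c = M" "x \<le> c \<and> c \<le> w x k \<or> w x k \<le> c \<and> c \<le> x" "w x k \<noteq> c"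
      using x by (metis linorder_not_le nless_le)
    then obtain j where "j \<le> k" "w x j = c" using nearest_neighbour_between[OF assms(1)] by blast
    then show False using that[of j] \<open>w x k \<noteq> c\<close> \<open>c = 0 \<or> c = M\<close> by (cases "j = k") auto
  qed
  have iff: "v x k \<in> ?C \<longleftrightarrow> w x k \<in> ?I" if "0 \<le> w x k" "w x k \<le> M" for k
    using that Cons.prems(1) by (cases "w x k = M") (auto simp: v_def)
  show ?case
  proof (cases w x ?I rule: first_hit_cases)
    case none
    then have "v x k \<notin> ?C" for k using inI[of k] iff[of k] by simp
    then have mv: "move v ?C x = ?C" by (rule move_no_hit)
    have mw: "move w ?I x = ?I" by (rule move_no_hit) (rule none)
    have L: "set L \<subseteq> {0<..<M}" using Cons.prems by auto
    show ?thesis unfolding foldl_Cons mv mw by (rule Cons.IH[OF Cons.prems(1) L])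
  next
    case (hit k)
    have bound: "0 \<le> w x j \<and> w x j \<le> M" if "j \<le> k" for j
      using inI[of j] hit(2) that by simp
    have k: "v x k \<in> ?C" using iff[of k] bound[of k] hit(1) by blast
    have k': "v x j \<notin> ?C" if "j < k" for j
    proof -
      have "0 \<le> w x j" "w x j \<le> M" using bound[of j] that by simp_all
      from iff[OF this] show ?thesis using hit(2)[OF that] by (simp only: not_False_eq_True)
    qed
    have mv: "move w ?I x = ?I - {w x k}" "move v ?C x = ?C - {v x k}"
      by (rule move_first_hit, fact hit(1), erule hit(2))
        (rule move_first_hit, fact k, erule k')
    show ?thesis
    proof (cases "w x k \<in> F")
      case True
      then have "w x k \<in> {0<..<M}" using Cons.prems by auto
      then have eqs: "?I - {w x k} = insert 0 (insert M (F - {w x k}))" "?C - {v x k} = insert 0 (F - {w x k})"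
        using assms(2) by (auto simp: v_def)
      have "F - {w x k} \<subseteq> {0<..<M}" "set L \<subseteq> {0<..<M}" using Cons.prems by auto
      from Cons.IH[OF this] show ?thesis unfolding foldl_Cons mv eqs .
    next
      case False
      \<comment> \<open>Filling either end of the interval fills the glued hole of the circle, so
        from now on both sides of the equivalence are false.\<close>
      then have "w x k = 0 \<or> w x k = M" using hit by auto
      then have "v x k = 0" by (auto simp: v_def)
      have "v x k \<notin> run v (?C - {v x k}) L" "w x k \<notin> run w (?I - {w x k}) L"
        using run_subset[of v "?C - {v x k}" L] run_subset[of w "?I - {w x k}" L] by fast+
      then have "0 \<notin> run v (move v ?C x) L" "w x k \<notin> run w (move w ?I x) L"
        unfolding mv using \<open>v x k = 0\<close> by simp_all
      then show ?thesis using \<open>w x k = 0 \<or> w x k = M\<close> unfolding foldl_Cons by metis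
    qed
  qed
qed

section \<open>The golf process on an interval and on a circle\<close>

definition holes_in :: "(int \<Rightarrow> site) \<Rightarrow> int \<Rightarrow> int \<Rightarrow> int set" where
  "holes_in \<omega> i j = {x \<in> {i..j}. st \<omega> x = Hole}"

definition balls_in :: "(int \<Rightarrow> site) \<Rightarrow> int \<Rightarrow> int \<Rightarrow> int list" where
  "balls_in \<omega> i j = sort_key (clock \<omega>) (filter (\<lambda>x. st \<omega> x = Ball \<and> clock \<omega> x \<le> 1) [i..j])"

text \<open>\<open>\<psi>\<close> is the identity on the line and reduction modulo \<open>M\<close> on the circle; \<open>F\<close> consists of
  additional holes, typically at the ends of \<open>[i, j]\<close>.\<close>
definition final :: "(int \<Rightarrow> int) \<Rightarrow> (int \<Rightarrow> site) \<Rightarrow> int \<Rightarrow> int \<Rightarrow> int set \<Rightarrow> int set" where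
  "final \<psi> \<omega> i j F = run (\<lambda>x k. \<psi> (walk \<omega> x k)) (F \<union> holes_in \<omega> i j) (balls_in \<omega> i j)"

lemma free_fin_eq: "free_fin n \<omega> = final id \<omega> (- int n) (int n) {}"
proof -
  have "ball_move \<omega> = move (walk \<omega>)"
    by (auto simp: fun_eq_iff ball_move_def move_def)
  then show ?thesis
    by (simp add: free_fin_def final_def holes_in_def balls_in_def)
qed

lemma nearest_neighbour_walk: "nearest_neighbour (walk \<omega>)"
  by (auto simp: nearest_neighbour_def walk_def)

lemma set_balls_in: "set (balls_in \<omega> i j) = {x \<in> {i..j}. st \<omega> x = Ball \<and> clock \<omega> x \<le> 1}"
  by (auto simp: balls_in_def)

lemma distinct_balls_in: "distinct (balls_in \<omega> i j)"
  by (simp add: balls_in_def)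

lemma finite_holes_in [simp]: "finite (holes_in \<omega> i j)"
  by (rule finite_subset[of _ "{i..j}"]) (auto simp: holes_in_def)

lemma filter_balls_in:
  assumes "i \<le> c" "c \<le> j"
  shows "filter (\<lambda>x. x < c) (balls_in \<omega> i j) = balls_in \<omega> i (c - 1)"
    "filter (\<lambda>x. c < x) (balls_in \<omega> i j) = balls_in \<omega> (c + 1) j"
proof -
  have "[i..j] = [i..c - 1] @ [c..j]" using assms by (intro upto_split1) auto
  also have "[c..j] = c # [c + 1..j]" using assms by (intro upto_rec1) auto
  finally have *: "[i..j] = [i..c - 1] @ c # [c + 1..j]" .
  have "filter (\<lambda>x. x < c) [i..j] = [i..c - 1]" "filter (\<lambda>x. c < x) [i..j] = [c + 1..j]"
    unfolding * by (auto simp: filter_empty_conv filter_id_conv)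
  then show "filter (\<lambda>x. x < c) (balls_in \<omega> i j) = balls_in \<omega> i (c - 1)"
    "filter (\<lambda>x. c < x) (balls_in \<omega> i j) = balls_in \<omega> (c + 1) j"
    unfolding balls_in_def filter_sort filter_filter
    by (simp_all add: conj_commute flip: filter_filter)
qed

lemma run_cong:
  assumes "\<And>x. x \<in> set L \<Longrightarrow> v x = v' x"
  shows "run v F L = run v' F L"
  using assms
proof (induction L arbitrary: F)
  case (Cons x L)
  have "move v F x = move v' F x" using Cons.prems by (simp add: move_def)
  then show ?case using Cons.IH[of "move v' F x"] Cons.prems by simp
qed simp

lemma sort_key_cong_on:
  assumes "\<And>x. x \<in> set xs \<Longrightarrow> f x = g x"
  shows "sort_key f xs = sort_key g xs"
proof -
  have *: "insort_key f x ys = insort_key g x ys" if "f x = g x" "\<And>y. y \<in> set ys \<Longrightarrow> f y = g y" for x ys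
    using that(2) by (induction ys) (simp_all add: that(1))
  show ?thesis using assms
  proof (induction xs)
    case (Cons a xs)
    then show ?case using *[of a "sort_key g xs"] by simp
  qed simp
qed

lemma balls_in_cong:
  assumes "\<And>x. i \<le> x \<Longrightarrow> x \<le> j \<Longrightarrow> \<omega> x = \<omega>' x"
  shows "balls_in \<omega> i j = balls_in \<omega>' i j"
proof -
  have "filter (\<lambda>x. st \<omega> x = Ball \<and> clock \<omega> x \<le> 1) [i..j] = filter (\<lambda>x. st \<omega>' x = Ball \<and> clock \<omega>' x \<le> 1) [i..j]"
    using assms by (intro filter_cong) (auto simp: st_def clock_def)
  moreover have "sort_key (clock \<omega>) xs = sort_key (clock \<omega>') xs" if "set xs \<subseteq> {i..j}" for xs
    using that assms by (intro sort_key_cong_on) (auto simp: clock_def)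
  ultimately show ?thesis by (simp add: balls_in_def subset_iff)
qed

lemma final_cong:
  assumes "\<And>x. i \<le> x \<Longrightarrow> x \<le> j \<Longrightarrow> \<omega> x = \<omega>' x"
  shows "final \<psi> \<omega> i j F = final \<psi> \<omega>' i j F"
proof -
  have "holes_in \<omega> i j = holes_in \<omega>' i j"
    using assms by (auto simp: holes_in_def st_def)
  moreover have "run (\<lambda>x k. \<psi> (walk \<omega> x k)) A (balls_in \<omega>' i j) = run (\<lambda>x k. \<psi> (walk \<omega>' x k)) A (balls_in \<omega>' i j)" for A
    using assms by (intro run_cong) (auto simp: set_balls_in walk_def steps_def)
  moreover have "balls_in \<omega> i j = balls_in \<omega>' i j" using assms by (rule balls_in_cong)
  ultimately show ?thesis by (simp add: final_def)
qed

lemma final_subset: "final \<psi> \<omega> i j F \<subseteq> F \<union> {i..j}"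
proof -
  have "final \<psi> \<omega> i j F \<subseteq> F \<union> holes_in \<omega> i j"
    unfolding final_def by (rule run_subset)
  then show ?thesis by (auto simp: holes_in_def)
qed

lemma final_hole: "x \<in> final \<psi> \<omega> i j F \<Longrightarrow> x \<notin> F \<Longrightarrow> st \<omega> x = Hole"
  using run_subset[of "\<lambda>x k. \<psi> (walk \<omega> x k)" "F \<union> holes_in \<omega> i j" "balls_in \<omega> i j"]
  by (auto simp: final_def holes_in_def)

text \<open>\<open>run_cut\<close> for windows. The site \<open>c\<close> leaves the window and
  enters both halves as an additional hole at the end; this is what the argument \<open>F\<close> of
  \<open>final\<close> is for.\<close>

lemma final_cut:
  fixes F :: "int set"
  assumes "i \<le> c" "c \<le> j" "st \<omega> c = Hole"
  defines "l \<equiv> final id \<omega> i (c - 1) (insert c (F \<inter> {..<c}))"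
    and "r \<equiv> final id \<omega> (c + 1) j (insert c (F \<inter> {c<..}))"
  shows "c \<in> final id \<omega> i j F \<longleftrightarrow> c \<in> l \<and> c \<in> r"
    and "c \<in> final id \<omega> i j F \<Longrightarrow> final id \<omega> i j F = l \<union> r"
proof -
  let ?F = "F \<union> holes_in \<omega> i j"
  have "?F \<inter> {..c} = insert c (F \<inter> {..<c}) \<union> holes_in \<omega> i (c - 1)"
    "?F \<inter> {c..} = insert c (F \<inter> {c<..}) \<union> holes_in \<omega> (c + 1) j"
    using assms(1-3) by (auto simp: holes_in_def)
  moreover have "c \<in> ?F" "c \<notin> set (balls_in \<omega> i j)"
    using assms(1-3) by (auto simp: holes_in_def set_balls_in)
  ultimately have "(c \<in> final id \<omega> i j F \<longleftrightarrow> c \<in> l \<and> c \<in> r) \<and>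
      (c \<in> final id \<omega> i j F \<longrightarrow> final id \<omega> i j F = l \<union> r)"
    using run_cut[OF nearest_neighbour_walk[of \<omega>], of c ?F "balls_in \<omega> i j"]
    by (simp add: final_def l_def r_def filter_balls_in[OF assms(1,2)])
  then show "c \<in> final id \<omega> i j F \<longleftrightarrow> c \<in> l \<and> c \<in> r"
    "c \<in> final id \<omega> i j F \<Longrightarrow> final id \<omega> i j F = l \<union> r" by simp_all
qed

section \<open>Surplus of holes and barriers\<close>

definition weight :: "site_state \<Rightarrow> int" where
  "weight s = (if s = Hole then 1 else if s = Ball then - 1 else 0)"

definition surplus :: "(int \<Rightarrow> site) \<Rightarrow> int set \<Rightarrow> int" where
  "surplus \<omega> I = (\<Sum>x\<in>I. weight (st \<omega> x))"

lemma surplus_eq_card: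
  assumes "finite I"
  shows "surplus \<omega> I = int (card {x \<in> I. st \<omega> x = Hole}) - int (card {x \<in> I. st \<omega> x = Ball})"
proof -
  have "weight s = of_bool (s = Hole) - of_bool (s = Ball)" for s
    by (cases s) (auto simp: weight_def)
  then have "surplus \<omega> I = (\<Sum>x\<in>I. of_bool (st \<omega> x = Hole)) - (\<Sum>x\<in>I. of_bool (st \<omega> x = Ball))"
    by (simp add: surplus_def sum_subtractf)
  then show ?thesis using assms by (simp add: of_bool_def sum.If_cases Int_def)
qed

text \<open>A barrier is a hole that no ball can reach, whatever the clocks and the walks are.\<close>
definition barrier :: "(int \<Rightarrow> site) \<Rightarrow> int \<Rightarrow> bool" where
  "barrier \<omega> c \<longleftrightarrow> st \<omega> c = Hole \<and>
     (\<forall>k::nat. 0 \<le> surplus \<omega> {c - int k..c - 1} \<and> 0 \<le> surplus \<omega> {c + 1..c + int k})"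

text \<open>The barrier condition says that every interval ending next to \<open>c\<close> has at
  least as many holes as balls, which is the counting hypothesis of
  \<open>run_untouched_from_left\<close> and its mirror image. Clipping the interval to the window
  leaves an interval next to \<open>c\<close>, and the extra holes in \<open>F\<close> can only
  increase the number of holes.\<close>

lemma barrier_untouched:
  assumes "barrier \<omega> c" "finite F" "c \<in> F"
  shows "c \<in> final id \<omega> i (c - 1) F" "c \<in> final id \<omega> (c + 1) j F"
proof -
  have count: "length (filter P (balls_in \<omega> a b)) \<le> card ((F \<union> holes_in \<omega> a b) \<inter> J)"
    if "\<And>x. a \<le> x \<and> x \<le> b \<and> P x \<longleftrightarrow> x \<in> I" "finite I" "0 \<le> surplus \<omega> I" "I \<subseteq> J" for P a b J I
  proof -
    have "length (filter P (balls_in \<omega> a b)) = card (set (filter P (balls_in \<omega> a b)))"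
      by (rule distinct_card[symmetric]) (simp add: distinct_balls_in)
    also have "\<dots> \<le> card {x \<in> I. st \<omega> x = Ball}"
      using that(1,2) by (intro card_mono) (auto simp: set_balls_in)
    also have "\<dots> \<le> card {x \<in> I. st \<omega> x = Hole}"
      using that(3) surplus_eq_card[OF that(2), of \<omega>] by simp
    also have "\<dots> \<le> card ((F \<union> holes_in \<omega> a b) \<inter> J)"
    proof (rule card_mono)
      show "finite ((F \<union> holes_in \<omega> a b) \<inter> J)" using assms(2) by simp
      show "{x \<in> I. st \<omega> x = Hole} \<subseteq> (F \<union> holes_in \<omega> a b) \<inter> J"
        using that(1,4) by (auto simp: holes_in_def)
    qed
    finally show ?thesis .
  qed
  have h: "0 \<le> surplus \<omega> {d..c - 1}" "0 \<le> surplus \<omega> {c + 1..d}" for d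
  proof -
    show "0 \<le> surplus \<omega> {d..c - 1}"
    proof (cases "d \<le> c")
      case True
      have "0 \<le> surplus \<omega> {c - int (nat (c - d))..c - 1}" using assms(1) unfolding barrier_def by blast
      then show ?thesis using True by simp
    qed (simp add: surplus_def)
    show "0 \<le> surplus \<omega> {c + 1..d}"
    proof (cases "c \<le> d")
      case True
      have "0 \<le> surplus \<omega> {c + 1..c + int (nat (d - c))}" using assms(1) unfolding barrier_def by blast
      then show ?thesis using True by simp
    qed (simp add: surplus_def)
  qed
  show "c \<in> final id \<omega> i (c - 1) F"
    unfolding final_def id_apply
  proof (rule run_untouched_from_left[OF nearest_neighbour_walk])
    fix d
    show "length (filter ((\<le>) d) (balls_in \<omega> i (c - 1))) \<le> card ((F \<union> holes_in \<omega> i (c - 1)) \<inter> {d..<c})"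
      by (rule count[of _ _ _ "{max d i..c - 1}"]) (use h in auto)
  qed (use assms in \<open>auto simp: set_balls_in\<close>)
  show "c \<in> final id \<omega> (c + 1) j F"
    unfolding final_def id_apply
  proof (rule run_untouched_from_right[OF nearest_neighbour_walk])
    fix d
    show "length (filter (\<lambda>x. x \<le> d) (balls_in \<omega> (c + 1) j)) \<le> card ((F \<union> holes_in \<omega> (c + 1) j) \<inter> {c<..d})"
      by (rule count[of _ _ _ "{c + 1..min d j}"]) (use h in auto)
  qed (use assms in \<open>auto simp: set_balls_in\<close>)
qed

lemma barrier_in_final:
  assumes "barrier \<omega> c" "i \<le> c" "c \<le> j"
  shows "c \<in> final id \<omega> i j {}"
  using final_cut(1)[OF assms(2,3), of \<omega> "{}"] barrier_untouched[OF assms(1), of "{c}"] assms(1)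
  by (auto simp: barrier_def)

text \<open>Two cuts, at \<open>c\<close> and at \<open>d\<close>. The point is that the right-hand
  side mentions neither \<open>i\<close> nor \<open>j\<close>: between two barriers the outcome is
  the same for all windows that contain both.\<close>

lemma final_between_barriers:
  assumes "barrier \<omega> c" "barrier \<omega> d" "i \<le> c" "c < y" "y < d" "d \<le> j"
  shows "y \<in> final id \<omega> i j {} \<longleftrightarrow> y \<in> final id \<omega> (c + 1) (d - 1) {c, d}"
proof -
  have st: "st \<omega> c = Hole" "st \<omega> d = Hole" using assms by (auto simp: barrier_def)
  have "c \<in> final id \<omega> i j {}" using assms by (intro barrier_in_final) auto
  then have 1: "final id \<omega> i j {} = final id \<omega> i (c - 1) {c} \<union> final id \<omega> (c + 1) j {c}"
    using final_cut(2)[of i c j \<omega> "{}"] assms st by simp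
  have "d \<in> final id \<omega> (c + 1) j {c}"
    using final_cut(1)[of "c + 1" d j \<omega> "{c}"] assms st
      barrier_untouched(1)[OF assms(2), of "{d, c}" "c + 1"] barrier_untouched(2)[OF assms(2), of "{d}" j]
    by simp
  then have 2: "final id \<omega> (c + 1) j {c} = final id \<omega> (c + 1) (d - 1) {d, c} \<union> final id \<omega> (d + 1) j {d}"
    using final_cut(2)[of "c + 1" d j \<omega> "{c}"] assms st by simp
  have "y \<notin> final id \<omega> i (c - 1) {c}" "y \<notin> final id \<omega> (d + 1) j {d}"
    using assms final_subset[of id \<omega> i "c - 1" "{c}"] final_subset[of id \<omega> "d + 1" j "{d}"] by auto
  then show ?thesis using 1 2 by (simp add: insert_commute)
qed

section \<open>Consecutive free holes, and the passage to a circle\<close>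

definition consecutive :: "int set \<Rightarrow> int \<Rightarrow> int \<Rightarrow> bool" where
  "consecutive S a b \<longleftrightarrow> a \<in> S \<and> b \<in> S \<and> (\<forall>y. a < y \<and> y < b \<longrightarrow> y \<notin> S)"

text \<open>Cuts at \<open>a\<close> and \<open>b\<close> resolve the event into five conditions
  that concern pairwise disjoint sets of sites. The middle one combines two demands: the balls
  between \<open>a\<close> and \<open>b\<close> fill all holes there, and none of them reaches an
  end.\<close>

lemma consecutive_final_iff:
  assumes "i \<le> a" "a < b" "b \<le> j"
  shows "consecutive (final id \<omega> i j {}) a b \<longleftrightarrow>
    st \<omega> a = Hole \<and> st \<omega> b = Hole \<and> a \<in> final id \<omega> i (a - 1) {a} \<and>
    final id \<omega> (a + 1) (b - 1) {a, b} = {a, b} \<and> b \<in> final id \<omega> (b + 1) j {b}"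
proof (cases "st \<omega> a = Hole \<and> st \<omega> b = Hole")
  case False
  then show ?thesis using final_hole[of a id \<omega> i j "{}"] final_hole[of b id \<omega> i j "{}"]
    by (auto simp: consecutive_def)
next
  case True
  let ?R = "final id \<omega> i j {}" and ?A = "final id \<omega> i (a - 1) {a}" and ?S = "final id \<omega> (a + 1) j {a}"
    and ?I = "final id \<omega> (a + 1) (b - 1) {a, b}" and ?B = "final id \<omega> (b + 1) j {b}"
  have a: "a \<in> ?R \<longleftrightarrow> a \<in> ?A \<and> a \<in> ?S" "a \<in> ?R \<Longrightarrow> ?R = ?A \<union> ?S"
    using final_cut[of i a j \<omega> "{}"] assms True by auto
  have b: "b \<in> ?S \<longleftrightarrow> b \<in> ?I \<and> b \<in> ?B" "b \<in> ?S \<Longrightarrow> ?S = ?I \<union> ?B"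
    using final_cut[of "a + 1" b j \<omega> "{a}"] assms True by (auto simp: insert_commute)
  have sub: "?A \<subseteq> {..a}" "?B \<subseteq> {b..}" "?I \<subseteq> {a..b}"
    using final_subset[of id \<omega> i "a - 1" "{a}"] final_subset[of id \<omega> "b + 1" j "{b}"]
      final_subset[of id \<omega> "a + 1" "b - 1" "{a, b}"] assms by auto
  show ?thesis
  proof (intro iffI)
    assume c: "consecutive ?R a b"
    then have R: "?R = ?A \<union> ?S" "a \<in> ?A" "a \<in> ?S" using a by (auto simp: consecutive_def)
    then have "b \<in> ?S" using c sub(1) assms by (auto simp: consecutive_def)
    then have S: "?S = ?I \<union> ?B" "b \<in> ?I" "b \<in> ?B" using b by auto
    have "a \<in> ?I" using R S sub(2) assms by auto
    have "?I \<subseteq> {a, b}"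
    proof
      fix y assume y: "y \<in> ?I"
      then have "y \<in> ?R" using R S by blast
      then have "\<not> (a < y \<and> y < b)" using c by (auto simp: consecutive_def)
      then show "y \<in> {a, b}" using y sub(3) by auto
    qed
    then show "st \<omega> a = Hole \<and> st \<omega> b = Hole \<and> a \<in> ?A \<and> ?I = {a, b} \<and> b \<in> ?B"
      using True R S \<open>a \<in> ?I\<close> by blast
  next
    assume c: "st \<omega> a = Hole \<and> st \<omega> b = Hole \<and> a \<in> ?A \<and> ?I = {a, b} \<and> b \<in> ?B"
    then have "b \<in> ?S" using b by simp
    then have S: "?S = {a, b} \<union> ?B" using b c by simp
    then have R: "?R = ?A \<union> ({a, b} \<union> ?B)" "a \<in> ?R" using a c by auto
    then show "consecutive ?R a b"
      using sub by (auto simp: consecutive_def)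
  qed
qed

text \<open>Translates the condition on the interior of a gap into one on a circle, where rotation
  symmetry is available. On the circle 0 is an ordinary site, so its being a hole has to be part of
  the event.\<close>

lemma circle_final_iff:
  assumes "0 < M"
  shows "final (\<lambda>y. y mod M) \<omega> 0 (M - 1) {} = {0} \<longleftrightarrow>
    st \<omega> 0 = Hole \<and> final id \<omega> 1 (M - 1) {0, M} = {0, M}"
proof (cases "st \<omega> 0 = Hole")
  case False
  then show ?thesis using final_hole[of 0 "\<lambda>y. y mod M" \<omega> 0 "M - 1" "{}"] by auto
next
  case True
  let ?H = "holes_in \<omega> 1 (M - 1)" and ?L = "balls_in \<omega> 1 (M - 1)"
  let ?C = "final (\<lambda>y. y mod M) \<omega> 0 (M - 1) {}" and ?I = "final id \<omega> 1 (M - 1) {0, M}"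
  have "[0..M - 1] = 0 # [0 + 1..M - 1]" using assms by (intro upto_rec1) auto
  then have b: "balls_in \<omega> 0 (M - 1) = ?L" using True by (simp add: balls_in_def)
  have h: "holes_in \<omega> 0 (M - 1) = insert 0 ?H" using True assms by (auto simp: holes_in_def)
  have C: "?C = run (\<lambda>x k. walk \<omega> x k mod M) (insert 0 ?H) ?L"
    unfolding final_def b h by simp
  have I: "?I = run (walk \<omega>) (insert 0 (insert M ?H)) ?L"
    unfolding final_def by simp
  have "?H \<subseteq> {0<..<M}" "set ?L \<subseteq> {0<..<M}" by (auto simp: holes_in_def set_balls_in)
  note circle = run_circle[OF nearest_neighbour_walk[of \<omega>] assms this, folded C I]
  have *: "0 \<in> ?C \<longleftrightarrow> 0 \<in> ?I \<and> M \<in> ?I" using circle by (rule conjunct1)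
  have **: "?I = insert M ?C" if "0 \<in> ?C" using circle that by (rule conjunct2[THEN mp])
  have "M \<notin> ?C" using final_subset[of "\<lambda>y. y mod M" \<omega> 0 "M - 1" "{}"] by auto
  show ?thesis
  proof
    assume "?C = {0}"
    then show "st \<omega> 0 = Hole \<and> ?I = {0, M}" using ** True by (simp add: insert_commute)
  next
    assume I: "st \<omega> 0 = Hole \<and> ?I = {0, M}"
    then have "0 \<in> ?C" unfolding * by simp
    with ** I have "insert M ?C = {0, M}" by simp
    then show "?C = {0}" using \<open>M \<notin> ?C\<close> assms by (simp add: insert_ident doubleton_eq_iff insert_commute[of 0 M])
  qed
qed

text \<open>Extended by the identity outside the circle, so that it is a bijection of all integers
  and can reindex the coordinates of \<open>golf_space\<close>.\<close>

definition rotation :: "int \<Rightarrow> int \<Rightarrow> int \<Rightarrow> int" where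
  "rotation M s x = (if x \<in> {0..<M} then (x + s) mod M else x)"

lemma rotation_bij:
  assumes "0 < M"
  shows "bij (rotation M s)" "rotation M s ` {0..<M} = {0..<M}"
proof -
  have inv: "rotation M (- s) (rotation M s x) = x" for x s
    using assms by (auto simp: rotation_def mod_diff_left_eq)
  show "bij (rotation M s)"
    using inv[of s] inv[of "- s"] by (intro o_bij[of "rotation M (- s)"]) (auto simp: fun_eq_iff)
  have r: "rotation M s x \<in> {0..<M}" if "x \<in> {0..<M}" for x s
    using that assms by (auto simp: rotation_def)
  show "rotation M s ` {0..<M} = {0..<M}"
  proof
    show "{0..<M} \<subseteq> rotation M s ` {0..<M}"
    proof
      fix x assume "x \<in> {0..<M}"
      then show "x \<in> rotation M s ` {0..<M}"
        using inv[of "- s" x] r[of x "- s"] by (metis image_eqI minus_minus)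
    qed
  qed (use r in blast)
qed

text \<open>The distinct clocks matter: sorting breaks ties by position, and a rotation does not
  preserve the order of positions. With distinct keys the sorted list is determined by its set of
  elements.\<close>

lemma final_rotation:
  assumes "0 < M" "inj_on (clock \<omega>) {0..<M}"
  shows "final (\<lambda>y. y mod M) \<omega> 0 (M - 1) {} =
    rotation M s ` final (\<lambda>y. y mod M) (\<omega> \<circ> rotation M s) 0 (M - 1) {}"
proof -
  let ?\<pi> = "rotation M s"
  have int: "{0..M - 1} = {0..<M}" by auto
  have mem: "?\<pi> x \<in> {0..<M} \<longleftrightarrow> x \<in> {0..<M}" for x
    using assms by (auto simp: rotation_def)
  have inj: "inj ?\<pi>" and surj: "surj ?\<pi>" using rotation_bij[OF assms(1)] by (auto simp: bij_def)
  have "walk \<omega> (?\<pi> x) k mod M = ?\<pi> (walk (\<omega> \<circ> ?\<pi>) x k mod M)" if "x \<in> {0..<M}" for x k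
  proof -
    let ?d = "\<Sum>i<k. if steps \<omega> (?\<pi> x) i then 1 else - 1 :: int"
    have "walk \<omega> (?\<pi> x) k mod M = ((x + s) mod M + ?d) mod M"
      using that by (simp add: walk_def rotation_def)
    also have "\<dots> = (x + ?d + s) mod M" by (simp add: mod_simps ac_simps)
    also have "\<dots> = ((x + ?d) mod M + s) mod M" by (simp add: mod_simps)
    also have "\<dots> = ?\<pi> ((x + ?d) mod M)" using assms(1) by (simp add: rotation_def)
    finally show ?thesis by (simp add: walk_def steps_def)
  qed
  then have "run (\<lambda>x k. walk \<omega> x k mod M) (?\<pi> ` holes_in (\<omega> \<circ> ?\<pi>) 0 (M - 1)) (map ?\<pi> (balls_in (\<omega> \<circ> ?\<pi>) 0 (M - 1)))
    = ?\<pi> ` run (\<lambda>x k. walk (\<omega> \<circ> ?\<pi>) x k mod M) (holes_in (\<omega> \<circ> ?\<pi>) 0 (M - 1)) (balls_in (\<omega> \<circ> ?\<pi>) 0 (M - 1))"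
    by (intro run_conj[OF inj]) (auto simp: set_balls_in)
  moreover have "?\<pi> ` holes_in (\<omega> \<circ> ?\<pi>) 0 (M - 1) = holes_in \<omega> 0 (M - 1)"
  proof -
    have "y \<in> ?\<pi> ` holes_in (\<omega> \<circ> ?\<pi>) 0 (M - 1) \<longleftrightarrow> y \<in> holes_in \<omega> 0 (M - 1)" for y
    proof -
      obtain x where "y = ?\<pi> x" using surj by blast
      then show ?thesis using inj mem[of x] by (auto simp: holes_in_def int st_def inj_image_mem_iff)
    qed
    then show ?thesis by blast
  qed
  moreover have "map ?\<pi> (balls_in (\<omega> \<circ> ?\<pi>) 0 (M - 1)) = balls_in \<omega> 0 (M - 1)"
    unfolding balls_in_def[of \<omega>]
  proof (rule sort_key_inj_key_eq[symmetric])
    let ?xs = "filter (\<lambda>x. st \<omega> x = Ball \<and> clock \<omega> x \<le> 1) [0..M - 1]"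
    show "inj_on (clock \<omega>) (set ?xs)"
      by (rule inj_on_subset[OF assms(2)]) auto
    show "sorted (map (clock \<omega>) (map ?\<pi> (balls_in (\<omega> \<circ> ?\<pi>) 0 (M - 1))))"
    proof -
      have "map (clock \<omega>) (map ?\<pi> xs) = map (clock (\<omega> \<circ> ?\<pi>)) xs" for xs by (simp add: clock_def)
      then show ?thesis by (simp only: balls_in_def sorted_sort_key)
    qed
    have "y \<in> set ?xs \<longleftrightarrow> y \<in> set (map ?\<pi> (balls_in (\<omega> \<circ> ?\<pi>) 0 (M - 1)))" for y
    proof -
      obtain x where "y = ?\<pi> x" using surj by blast
      then show ?thesis using inj mem[of x]
        by (auto simp: set_balls_in int st_def clock_def inj_image_mem_iff)
    qed
    then have "set ?xs = set (map ?\<pi> (balls_in (\<omega> \<circ> ?\<pi>) 0 (M - 1)))" by blast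
    moreover have "distinct (map ?\<pi> (balls_in (\<omega> \<circ> ?\<pi>) 0 (M - 1)))"
      using inj by (simp add: distinct_map distinct_balls_in inj_on_subset[OF inj])
    ultimately show "mset ?xs = mset (map ?\<pi> (balls_in (\<omega> \<circ> ?\<pi>) 0 (M - 1)))"
      by (subst set_eq_iff_mset_eq_distinct[symmetric]) simp_all
  qed
  ultimately show ?thesis by (simp add: final_def)
qed

text \<open>Each walk visits the whole circle and each ball fires before time 1, so every ball fills
  a hole as long as one is left. The number of free holes at the end is thus the number of holes
  minus the number of balls, whatever the order and the paths.\<close>

lemma circle_single_iff:
  assumes "0 < M" "\<And>x. x \<in> {0..<M} \<Longrightarrow> clock \<omega> x \<le> 1"
    and "\<And>x y. x \<in> {0..<M} \<Longrightarrow> y \<in> {0..<M} \<Longrightarrow> \<exists>k. walk \<omega> x k mod M = y"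
  shows "(\<exists>x\<in>{0..<M}. final (\<lambda>y. y mod M) \<omega> 0 (M - 1) {} = {x}) \<longleftrightarrow> surplus \<omega> {0..<M} = 1"
proof -
  let ?C = "final (\<lambda>y. y mod M) \<omega> 0 (M - 1) {}"
  have int: "{0..M - 1} = {0..<M}" by auto
  have "card ?C = card (holes_in \<omega> 0 (M - 1)) - length (balls_in \<omega> 0 (M - 1))"
    unfolding final_def Un_empty_left
  proof (rule card_run)
    show "\<exists>k. walk \<omega> x k mod M = y" if "x \<in> set (balls_in \<omega> 0 (M - 1))" "y \<in> holes_in \<omega> 0 (M - 1)" for x y
      using that by (intro assms(3)) (auto simp: set_balls_in holes_in_def)
  qed simp
  also have "length (balls_in \<omega> 0 (M - 1)) = card (set (balls_in \<omega> 0 (M - 1)))"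
    by (rule distinct_card[symmetric]) (rule distinct_balls_in)
  also have "set (balls_in \<omega> 0 (M - 1)) = {x \<in> {0..<M}. st \<omega> x = Ball}"
    unfolding set_balls_in int using assms(2) by auto
  finally have "card ?C = 1 \<longleftrightarrow> surplus \<omega> {0..<M} = 1"
    by (auto simp: surplus_eq_card holes_in_def int)
  moreover have "card ?C = 1 \<longleftrightarrow> (\<exists>x\<in>{0..<M}. ?C = {x})"
  proof
    assume "card ?C = 1"
    then obtain x where "?C = {x}" by (rule card_1_singletonE)
    then show "\<exists>x\<in>{0..<M}. ?C = {x}"
      using final_subset[of "\<lambda>y. y mod M" \<omega> 0 "M - 1" "{}"] int by auto
  qed auto
  ultimately show ?thesis by simp
qed

section \<open>Holes free in infinite volume and the gap around 0\<close>

lemma H1_between_barriers: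
  assumes "barrier \<omega> c" "barrier \<omega> d" "c < y" "y < d"
  shows "y \<in> H1 \<omega> \<longleftrightarrow> y \<in> final id \<omega> (c + 1) (d - 1) {c, d}"
proof -
  define m where "m = nat (max \<bar>c\<bar> \<bar>d\<bar>)"
  have "y \<in> free_fin n \<omega> \<longleftrightarrow> y \<in> final id \<omega> (c + 1) (d - 1) {c, d}" if "m \<le> n" for n
  proof -
    have "- int n \<le> c" "d \<le> int n" using that by (auto simp: m_def)
    then show ?thesis unfolding free_fin_eq using assms by (intro final_between_barriers) auto
  qed
  then have "\<forall>\<^sub>F n in sequentially. (y \<in> free_fin n \<omega> \<longleftrightarrow> y \<in> final id \<omega> (c + 1) (d - 1) {c, d})"
    unfolding eventually_sequentially by blast
  then have "(\<forall>\<^sub>F n in sequentially. y \<in> free_fin n \<omega>) \<longleftrightarrow>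
      (\<forall>\<^sub>F n in sequentially. y \<in> final id \<omega> (c + 1) (d - 1) {c, d})"
    by (rule eventually_subst)
  then show ?thesis by (simp add: H1_def)
qed

lemma barrier_in_H1:
  assumes "barrier \<omega> c"
  shows "c \<in> H1 \<omega>"
proof -
  have "c \<in> free_fin n \<omega>" if "nat \<bar>c\<bar> \<le> n" for n
    unfolding free_fin_eq using that by (intro barrier_in_final assms) auto
  then show ?thesis unfolding H1_def eventually_sequentially by blast
qed

text \<open>Once \<open>b = a + l + 1\<close>, the requirement \<open>a \<le> 0 < b\<close> leaves
  exactly \<open>l + 1\<close> positions for \<open>a\<close>. This factor later cancels the
  \<open>1 / (l + 1)\<close> that comes from the circle.\<close>

lemma gap0_eq_iff: "gap0_eq \<omega> (int l) \<longleftrightarrow> (\<exists>a\<in>{- int l..0}. consecutive (H1 \<omega>) a (a + int l + 1))"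
proof
  assume "gap0_eq \<omega> (int l)"
  then obtain a b where ab: "a \<le> 0" "0 < b" "b - a - 1 = int l" "consecutive (H1 \<omega>) a b"
    unfolding gap0_eq_def consecutive_def by blast
  then have "a \<in> {- int l..0}" "b = a + int l + 1" by auto
  then show "\<exists>a\<in>{- int l..0}. consecutive (H1 \<omega>) a (a + int l + 1)" using ab by blast
next
  assume "\<exists>a\<in>{- int l..0}. consecutive (H1 \<omega>) a (a + int l + 1)"
  then obtain a where "a \<in> {- int l..0}" "consecutive (H1 \<omega>) a (a + int l + 1)" by blast
  then show "gap0_eq \<omega> (int l)"
    unfolding gap0_eq_def consecutive_def by (intro exI[of _ a] exI[of _ "a + int l + 1"]) auto
qed

lemma consecutive_unique:
  assumes "consecutive S a b" "consecutive S a' b'" "a \<le> 0" "0 < b" "a' \<le> 0" "0 < b'"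
  shows "a = a'" "b = b'"
proof -
  show "a = a'" using assms unfolding consecutive_def by (smt (verit))
  show "b = b'" using assms unfolding consecutive_def by (smt (verit))
qed

lemma ex_gap0_eq:
  assumes "c \<in> H1 \<omega>" "c \<le> 0" "d \<in> H1 \<omega>" "0 < d"
  shows "\<exists>l. gap0_eq \<omega> (int l)"
proof -
  let ?A = "H1 \<omega> \<inter> {c..0}" and ?B = "H1 \<omega> \<inter> {1..d}"
  define a where "a = Max ?A"
  define b where "b = Min ?B"
  have A: "finite ?A" "?A \<noteq> {}" and B: "finite ?B" "?B \<noteq> {}" using assms by auto
  have a: "a \<in> ?A" unfolding a_def by (rule Max_in[OF A])
  have b: "b \<in> ?B" unfolding b_def by (rule Min_in[OF B])
  have "y \<notin> H1 \<omega>" if "a < y" "y < b" for y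
  proof
    assume y: "y \<in> H1 \<omega>"
    show False
    proof (cases "y \<le> 0")
      case True
      then have "y \<in> ?A" using y a that by auto
      then have "y \<le> a" unfolding a_def using A by simp
      then show False using that by simp
    next
      case False
      then have "y \<in> ?B" using y b that by auto
      then have "b \<le> y" unfolding b_def using B by simp
      then show False using that by simp
    qed
  qed
  then have "gap0_eq \<omega> (int (nat (b - a - 1)))"
    unfolding gap0_eq_def using a b by (intro exI[of _ a] exI[of _ b]) auto
  then show ?thesis ..
qed

section \<open>Products of identically distributed sites\<close>

lemma (in prob_space) prob_tendsto_of_AE_eventually:
  assumes "\<And>n. A n \<in> events" "B \<in> events" "AE x in M. \<forall>\<^sub>F n in sequentially. (x \<in> A n \<longleftrightarrow> x \<in> B)"
  shows "(\<lambda>n. prob (A n)) \<longlonglongrightarrow> prob B"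
proof -
  have "(\<lambda>n. \<integral>x. indicator (A n) x \<partial>M) \<longlonglongrightarrow> (\<integral>x. indicator B x \<partial>M :: real)"
  proof (rule integral_dominated_convergence[where w = "\<lambda>_. 1"])
    show "AE x in M. (\<lambda>n. indicator (A n) x :: real) \<longlonglongrightarrow> indicator B x"
      using assms(3)
    proof (rule AE_mp, intro AE_I2 impI)
      fix x assume "\<forall>\<^sub>F n in sequentially. (x \<in> A n \<longleftrightarrow> x \<in> B)"
      then have "\<forall>\<^sub>F n in sequentially. (indicator (A n) x :: real) = indicator B x"
        by (rule eventually_mono) (simp add: indicator_def)
      then show "(\<lambda>n. indicator (A n) x :: real) \<longlonglongrightarrow> indicator B x"
        by (rule tendsto_eventually)
    qed
  qed (use assms in auto)
  then show ?thesis using assms by (simp add: sets.Int_space_eq2)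
qed

text \<open>Replaces measurability with respect to the coordinates in \<open>I\<close> by a
  pointwise condition that is easy to check; \<open>prob_conj_disjoint\<close> turns it into
  independence.\<close>

definition depends_on :: "(('i \<Rightarrow> 'a) \<Rightarrow> bool) \<Rightarrow> 'i set \<Rightarrow> bool" where
  "depends_on P I \<longleftrightarrow> (\<forall>\<omega> \<omega>'. (\<forall>x\<in>I. \<omega> x = \<omega>' x) \<longrightarrow> P \<omega> = P \<omega>')"

lemma depends_on_conj: "depends_on P I \<Longrightarrow> depends_on Q J \<Longrightarrow> depends_on (\<lambda>\<omega>. P \<omega> \<and> Q \<omega>) (I \<union> J)"
  unfolding depends_on_def by (metis UnI1 UnI2)

text \<open>Instantiated twice, for the steps of one walk (indexed by \<open>nat\<close>) and for
  the sites (indexed by \<open>int\<close>); the argument \<open>dummy\<close> only fixes the index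
  type.\<close>

locale iid_space =
  fixes S :: "'a measure" and dummy :: "'i itself"
  assumes prob_S: "prob_space S" and space_S: "space S = UNIV"
begin

abbreviation N :: "('i \<Rightarrow> 'a) measure" where
  "N \<equiv> PiM UNIV (\<lambda>_. S)"

lemma prob_space_N: "prob_space N"
  by (intro prob_space_PiM prob_S)

sublocale prob_space N
  by (rule prob_space_N)

lemma space_N [simp]: "space N = UNIV"
  by (simp add: space_PiM space_S PiE_UNIV_domain)

lemma pred_sets_N: "Measurable.pred N P \<Longrightarrow> {\<omega>. P \<omega>} \<in> events"
  by (simp add: pred_def)

lemma distr_coordinate: "distr N S (\<lambda>\<omega>. \<omega> i) = S"
  using distr_PiM_component[of UNIV "\<lambda>_. S" i] prob_S by simp

lemma prob_UNIV [simp]: "prob UNIV = 1"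
  using prob_space by simp

lemma prob_not: "Measurable.pred N P \<Longrightarrow> prob {\<omega>. \<not> P \<omega>} = 1 - prob {\<omega>. P \<omega>}"
  using prob_neg[of P] pred_sets_N[of P] by simp

lemma indep_vars_coordinates: "indep_vars (\<lambda>_. S) (\<lambda>x \<omega>. \<omega> x) (UNIV :: 'i set)"
proof (subst indep_vars_iff_distr_eq_PiM')
  have "distr N N (\<lambda>x. \<lambda>i\<in>UNIV. x i) = N"
    by (simp add: restrict_UNIV distr_id)
  then show "distr N N (\<lambda>x. \<lambda>i\<in>UNIV. x i) = PiM UNIV (\<lambda>i. distr N S (\<lambda>\<omega>. \<omega> i))"
    by (simp add: distr_coordinate)
qed simp_all

lemma prob_conj_disjoint:
  assumes P: "Measurable.pred N P" "depends_on P I" and Q: "Measurable.pred N Q" "depends_on Q J"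
    and disj: "I \<inter> J = {}"
  shows "prob {\<omega>. P \<omega> \<and> Q \<omega>} = prob {\<omega>. P \<omega>} * prob {\<omega>. Q \<omega>}"
proof -
  have ex: "\<exists>A \<in> sets (PiM I (\<lambda>_. S)). \<forall>\<omega>. restrict \<omega> I \<in> A \<longleftrightarrow> P \<omega>"
    if P: "Measurable.pred N P" "depends_on P I" for P I
  proof -
    \<comment> \<open>\<open>e\<close> extends a family on \<open>I\<close> to all indices by
      \<open>undefined\<close>, a legitimate value because \<open>space S\<close> is everything. By
      \<open>depends_on\<close> this does not change the truth of \<open>P\<close>, so
      \<open>P\<close> corresponds to a measurable set of the product over \<open>I\<close>
      alone.\<close>
    define e :: "('i \<Rightarrow> 'a) \<Rightarrow> 'i \<Rightarrow> 'a" where "e f i = (if i \<in> I then f i else undefined)" for f i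
    have "e \<in> PiM I (\<lambda>_. S) \<rightarrow>\<^sub>M N"
    proof (rule measurable_abs_UNIV[of "\<lambda>i f. e f i", simplified])
      fix i
      show "(\<lambda>f. e f i) \<in> PiM I (\<lambda>_. S) \<rightarrow>\<^sub>M S"
        by (cases "i \<in> I") (auto simp: e_def space_S)
    qed
    from measurable_sets[OF this pred_sets_N[OF P(1)]]
    have "e -` {\<omega>. P \<omega>} \<inter> space (PiM I (\<lambda>_. S)) \<in> sets (PiM I (\<lambda>_. S))" .
    moreover have "restrict \<omega> I \<in> e -` {\<omega>. P \<omega>} \<inter> space (PiM I (\<lambda>_. S)) \<longleftrightarrow> P \<omega>" for \<omega>
    proof -
      have "P (e (restrict \<omega> I)) = P \<omega>"
        using P(2) by (simp add: depends_on_def e_def)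
      then show ?thesis by (simp add: space_PiM space_S)
    qed
    ultimately show ?thesis by blast
  qed
  obtain A where A: "A \<in> sets (PiM I (\<lambda>_. S))" "\<And>\<omega>. restrict \<omega> I \<in> A \<longleftrightarrow> P \<omega>"
    using ex[OF P] by blast
  obtain B where B: "B \<in> sets (PiM J (\<lambda>_. S))" "\<And>\<omega>. restrict \<omega> J \<in> B \<longleftrightarrow> Q \<omega>"
    using ex[OF Q] by blast
  have "indep_var (PiM I (\<lambda>_. S)) (\<lambda>\<omega>. restrict \<omega> I) (PiM J (\<lambda>_. S)) (\<lambda>\<omega>. restrict \<omega> J)"
    using indep_var_restrict[OF indep_vars_coordinates disj] by simp
  from indep_varD[OF this A(1) B(1)] show ?thesis
    using A(2) B(2) by (simp add: vimage_def)
qed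

text \<open>Stated for finitely many events, since in the barrier argument the events themselves
  change with the truncation level, and the number of events has to stay fixed while that level
  grows.\<close>

lemma prob_none_le:
  assumes P: "\<And>i. i < n \<Longrightarrow> Measurable.pred N (P i)" "\<And>i. i < n \<Longrightarrow> depends_on (P i) (I i)"
    and disj: "\<And>i j. i < j \<Longrightarrow> j < n \<Longrightarrow> I i \<inter> I j = {}"
    and ge: "\<And>i. i < n \<Longrightarrow> \<delta> \<le> prob {\<omega>. P i \<omega>}" and "\<delta> \<le> 1"
  shows "prob {\<omega>. \<forall>i<n::nat. \<not> P i \<omega>} \<le> (1 - \<delta>) ^ n"
  using assms(1-4)
proof (induction n)
  case (Suc n)
  have P' [measurable]: "Measurable.pred N (P i)" if "i < Suc n" for i using Suc.prems(1) that .
  have "prob {\<omega>. \<forall>i<Suc n. \<not> P i \<omega>} = prob {\<omega>. (\<forall>i<n. \<not> P i \<omega>) \<and> \<not> P n \<omega>}"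
    by (simp add: less_Suc_eq all_conj_distrib conj_commute imp_disjL)
  also have "\<dots> = prob {\<omega>. \<forall>i<n. \<not> P i \<omega>} * prob {\<omega>. \<not> P n \<omega>}"
  proof (rule prob_conj_disjoint)
    have "Measurable.pred N (\<lambda>\<omega>. \<forall>i\<in>{..<n}. \<not> P i \<omega>)"
      by (intro pred_intros_countable_bounded pred_intros_logic P') auto
    then show "Measurable.pred N (\<lambda>\<omega>. \<forall>i<n. \<not> P i \<omega>)" by (simp add: Ball_def)
    show "Measurable.pred N (\<lambda>\<omega>. \<not> P n \<omega>)" by (intro pred_intros_logic P') simp
    show "depends_on (\<lambda>\<omega>. \<forall>i<n. \<not> P i \<omega>) (\<Union>i<n. I i)"
      unfolding depends_on_def
    proof (intro allI impI)
      fix \<omega> \<omega>' :: "'i \<Rightarrow> 'a"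
      assume *: "\<forall>x\<in>\<Union>i<n. I i. \<omega> x = \<omega>' x"
      have "P i \<omega> = P i \<omega>'" if "i < n" for i
        using Suc.prems(2)[of i] that * by (auto simp: depends_on_def)
      then show "(\<forall>i<n. \<not> P i \<omega>) = (\<forall>i<n. \<not> P i \<omega>')" by simp
    qed
    show "depends_on (\<lambda>\<omega>. \<not> P n \<omega>) (I n)" using Suc.prems(2)[of n] by (auto simp: depends_on_def)
    show "(\<Union>i<n. I i) \<inter> I n = {}" using Suc.prems(3)[of _ n] by blast
  qed
  also have "prob {\<omega>. \<not> P n \<omega>} = 1 - prob {\<omega>. P n \<omega>}"
    using prob_neg[of "P n"] pred_sets_N[OF P'[of n]] by simp
  also have "prob {\<omega>. \<forall>i<n. \<not> P i \<omega>} * (1 - prob {\<omega>. P n \<omega>}) \<le> (1 - \<delta>) ^ n * (1 - \<delta>)"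
  proof (rule mult_mono)
    show "prob {\<omega>. \<forall>i<n. \<not> P i \<omega>} \<le> (1 - \<delta>) ^ n"
      by (rule Suc.IH) (use Suc.prems in auto)
  qed (use Suc.prems(4)[of n] assms(5) in auto)
  finally show ?case by (simp add: mult.commute)
qed simp

text \<open>A subfamily of i.i.d. coordinates, listed without repetition, has the same law. Used for
  translations and for rotations.\<close>

lemma prob_reindex:
  fixes \<pi> :: "'i \<Rightarrow> 'i"
  assumes "inj \<pi>" "Measurable.pred N P"
  shows "prob {\<omega>. P (\<omega> \<circ> \<pi>)} = prob {\<omega>. P \<omega>}"
proof -
  have d: "distr N N (\<lambda>\<omega>. \<omega> \<circ> \<pi>) = N"
    using distr_PiM_reindex[of UNIV "\<lambda>_. S" \<pi> UNIV] prob_S assms(1)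
    by (simp add: restrict_UNIV comp_def)
  have m: "(\<lambda>\<omega>. \<omega> \<circ> \<pi>) \<in> N \<rightarrow>\<^sub>M N"
    unfolding comp_def by (intro measurable_abs_UNIV) auto
  have "prob {\<omega>. P \<omega>} = measure (distr N N (\<lambda>\<omega>. \<omega> \<circ> \<pi>)) {\<omega>. P \<omega>}" by (simp only: d)
  also have "\<dots> = prob {\<omega>. P (\<omega> \<circ> \<pi>)}"
    using measure_distr[OF m pred_sets_N[OF assms(2)]] by (simp add: vimage_def)
  finally show ?thesis ..
qed

lemma prob_coordinate:
  assumes "A \<in> sets S"
  shows "prob {\<omega>. \<omega> x \<in> A} = measure S A"
proof -
  have "measure S A = measure (distr N S (\<lambda>\<omega>. \<omega> x)) A"
    by (simp add: distr_coordinate)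
  also have "\<dots> = prob {\<omega>. \<omega> x \<in> A}"
    using measure_distr[OF _ assms, of "\<lambda>\<omega>. \<omega> x" N] by (simp add: vimage_def)
  finally show ?thesis ..
qed


lemma prob_all_coordinates:
  assumes A: "A \<in> sets S" and "finite J"
  shows "prob {\<omega>. \<forall>x\<in>J. \<omega> x \<in> A} = measure S A ^ card J"
  using assms(2)
proof (induction J)
  case empty
  then show ?case using prob_space by simp
next
  case (insert x J)
  have [measurable]: "Measurable.pred N (\<lambda>\<omega>. \<omega> x \<in> A)" for x
    using measurable_sets[OF measurable_component_singleton[of x UNIV "\<lambda>_. S"] A]
    by (simp add: pred_def vimage_def)
  have "prob {\<omega>. \<omega> x \<in> A \<and> (\<forall>y\<in>J. \<omega> y \<in> A)} = prob {\<omega>. \<omega> x \<in> A} * prob {\<omega>. \<forall>y\<in>J. \<omega> y \<in> A}"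
  proof (rule prob_conj_disjoint)
    show "depends_on (\<lambda>\<omega>. \<omega> x \<in> A) {x}" "depends_on (\<lambda>\<omega>. \<forall>y\<in>J. \<omega> y \<in> A) J"
      by (auto simp: depends_on_def)
    show "Measurable.pred N (\<lambda>\<omega>. \<forall>y\<in>J. \<omega> y \<in> A)"
      using insert.hyps(1) by measurable
  qed (use insert.hyps in auto)
  then show ?case using insert by (simp add: prob_coordinate[OF A])
qed

lemma AE_exists_disjoint:
  fixes P :: "nat \<Rightarrow> ('i \<Rightarrow> 'a) \<Rightarrow> bool"
  assumes [measurable]: "\<And>i. Measurable.pred N (P i)" and "\<And>i. depends_on (P i) (I i)"
    and "\<And>i j. i < j \<Longrightarrow> I i \<inter> I j = {}" and "\<And>i. \<delta> \<le> prob {\<omega>. P i \<omega>}" and "0 < \<delta>" "\<delta> \<le> 1"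
  shows "AE \<omega> in N. \<exists>i. P i \<omega>"
proof -
  have m: "{\<omega>. \<forall>i. \<not> P i \<omega>} \<in> events" by (rule pred_sets_N) measurable
  have "prob {\<omega>. \<forall>i. \<not> P i \<omega>} \<le> (1 - \<delta>) ^ n" for n
  proof -
    have "{\<omega>. \<forall>i<n. \<not> P i \<omega>} \<in> events" by (rule pred_sets_N) measurable
    then have "prob {\<omega>. \<forall>i. \<not> P i \<omega>} \<le> prob {\<omega>. \<forall>i<n. \<not> P i \<omega>}"
      by (intro finite_measure_mono) auto
    also have "\<dots> \<le> (1 - \<delta>) ^ n"
      using assms by (intro prob_none_le[where I = I]) auto
    finally show ?thesis .
  qed
  moreover have "(\<lambda>n. (1 - \<delta>) ^ n) \<longlonglongrightarrow> 0"
    using assms(5,6) by (intro LIMSEQ_realpow_zero) auto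
  ultimately have "prob {\<omega>. \<forall>i. \<not> P i \<omega>} \<le> 0"
    by (intro LIMSEQ_le_const[of "\<lambda>n. (1 - \<delta>) ^ n"]) auto
  then have "prob {\<omega>. \<forall>i. \<not> P i \<omega>} = 0" by (simp add: measure_le_0_iff)
  then have "AE \<omega> in N. \<omega> \<notin> {\<omega>. \<forall>i. \<not> P i \<omega>}"
    using m by (simp add: prob_eq_0)
  then show ?thesis by simp
qed

end

section \<open>Locality and translation of the process\<close>

lemma depends_on_final: "depends_on (\<lambda>\<omega>. P (final \<psi> \<omega> i j F)) {i..j}"
  unfolding depends_on_def
proof (intro allI impI)
  fix \<omega> \<omega>' :: "int \<Rightarrow> site"
  assume "\<forall>x\<in>{i..j}. \<omega> x = \<omega>' x"
  then have "final \<psi> \<omega> i j F = final \<psi> \<omega>' i j F" by (intro final_cong) auto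
  then show "P (final \<psi> \<omega> i j F) = P (final \<psi> \<omega>' i j F)" by simp
qed

lemma depends_on_surplus: "depends_on (\<lambda>\<omega>. P (surplus \<omega> I)) I"
  unfolding depends_on_def
proof (intro allI impI)
  fix \<omega> \<omega>' :: "int \<Rightarrow> site"
  assume "\<forall>x\<in>I. \<omega> x = \<omega>' x"
  then have "surplus \<omega> I = surplus \<omega>' I" unfolding surplus_def by (intro sum.cong) (auto simp: st_def)
  then show "P (surplus \<omega> I) = P (surplus \<omega>' I)" by simp
qed

lemma depends_on_st: "depends_on (\<lambda>\<omega>. P (st \<omega> x)) {x}"
  by (auto simp: depends_on_def st_def)

text \<open>A translation is monotone and therefore respects the tie-breaking by position as well as
  the clocks, so that the identity holds for every \<omega>.\<close>

lemma final_shift: "final id (\<omega> \<circ> (\<lambda>x. x + s)) i j F = (\<lambda>x. x - s) ` final id \<omega> (i + s) (j + s) ((\<lambda>x. x + s) ` F)"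
proof -
  let ?\<pi> = "\<lambda>x::int. x + s"
  have inj: "inj ?\<pi>" by (simp add: inj_def)
  have upto: "[i + s..j + s] = map ?\<pi> [i..j]"
  proof (rule sorted_distinct_set_unique)
    show "sorted (map ?\<pi> [i..j])" by (simp add: sorted_map sorted_wrt_mono_rel[OF _ sorted_upto])
    show "set [i + s..j + s] = set (map ?\<pi> [i..j])" by (simp add: image_add_atLeastAtMost')
  qed (auto simp: distinct_map inj_on_def)
  have sort: "map ?\<pi> (sort_key (\<lambda>x. f (x + s)) xs) = sort_key f (map ?\<pi> xs)" for f :: "int \<Rightarrow> real" and xs
  proof (induction xs)
    case (Cons x xs)
    have "map ?\<pi> (insort_key (\<lambda>x. f (x + s)) x ys) = insort_key f (?\<pi> x) (map ?\<pi> ys)" for ys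
      by (induction ys) auto
    then show ?case using Cons.IH by simp
  qed simp
  have cl: "clock (\<omega> \<circ> ?\<pi>) = (\<lambda>x. clock \<omega> (x + s))" by (simp add: fun_eq_iff clock_def)
  have "map ?\<pi> (balls_in (\<omega> \<circ> ?\<pi>) i j) = balls_in \<omega> (i + s) (j + s)"
    unfolding balls_in_def cl sort[of "clock \<omega>"] upto by (simp add: filter_map comp_def st_def)
  moreover have "?\<pi> ` (F \<union> holes_in (\<omega> \<circ> ?\<pi>) i j) = ?\<pi> ` F \<union> holes_in \<omega> (i + s) (j + s)"
  proof -
    have "?\<pi> ` holes_in (\<omega> \<circ> ?\<pi>) i j = holes_in \<omega> (i + s) (j + s)"
    proof (intro set_eqI iffI)
      fix y assume "y \<in> holes_in \<omega> (i + s) (j + s)"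
      then show "y \<in> ?\<pi> ` holes_in (\<omega> \<circ> ?\<pi>) i j"
        by (intro image_eqI[of _ _ "y - s"]) (auto simp: holes_in_def st_def)
    qed (auto simp: holes_in_def st_def)
    then show ?thesis by (simp add: image_Un)
  qed
  moreover have "run (walk \<omega>) (?\<pi> ` (F \<union> holes_in (\<omega> \<circ> ?\<pi>) i j)) (map ?\<pi> (balls_in (\<omega> \<circ> ?\<pi>) i j)) =
      ?\<pi> ` run (walk (\<omega> \<circ> ?\<pi>)) (F \<union> holes_in (\<omega> \<circ> ?\<pi>) i j) (balls_in (\<omega> \<circ> ?\<pi>) i j)"
    by (rule run_conj[OF inj]) (simp add: walk_def steps_def)
  ultimately have "final id \<omega> (i + s) (j + s) (?\<pi> ` F) = ?\<pi> ` final id (\<omega> \<circ> ?\<pi>) i j F"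
    by (simp add: final_def)
  then show ?thesis by (simp add: image_image)
qed

section \<open>Counting the states in a finite set of sites\<close>

lemma surplus_insert:
  assumes "finite I" "x \<notin> I"
  shows "surplus \<omega> (insert x I) = weight (st \<omega> x) + surplus \<omega> I"
  using assms by (simp add: surplus_def)

lemma weight_simps [simp]: "weight Ball = - 1" "weight Hole = 1" "weight Neutral = 0"
  by (simp_all add: weight_def)

definition site_count :: "(int \<Rightarrow> site) \<Rightarrow> int set \<Rightarrow> site_state \<Rightarrow> nat" where
  "site_count \<omega> I s = card {x \<in> I. st \<omega> x = s}"

lemma site_count_insert:
  assumes "finite I" "x \<notin> I"
  shows "site_count \<omega> (insert x I) s = site_count \<omega> I s + of_bool (st \<omega> x = s)"
proof -
  have "{y \<in> insert x I. st \<omega> y = s} = (if st \<omega> x = s then insert x {y \<in> I. st \<omega> y = s} else {y \<in> I. st \<omega> y = s})"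
    by auto
  then show ?thesis using assms by (simp add: site_count_def)
qed

lemma site_count_total:
  "finite I \<Longrightarrow> site_count \<omega> I Ball + site_count \<omega> I Hole + site_count \<omega> I Neutral = card I"
proof (induction I rule: finite_induct)
  case (insert x I)
  then show ?case by (cases "st \<omega> x") (simp_all add: site_count_insert)
qed (simp add: site_count_def)

text \<open>Truncated barriers that are more than \<open>2J\<close> apart are independent.\<close>
definition barrier_upto :: "nat \<Rightarrow> (int \<Rightarrow> site) \<Rightarrow> int \<Rightarrow> bool" where
  "barrier_upto J \<omega> c \<longleftrightarrow> st \<omega> c = Hole \<and>
     (\<forall>k\<in>{..J}. 0 \<le> surplus \<omega> {c - int k..c - 1} \<and> 0 \<le> surplus \<omega> {c + 1..c + int k})"

lemma barrier_imp_upto: "barrier \<omega> c \<Longrightarrow> barrier_upto J \<omega> c"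
  by (simp add: barrier_def barrier_upto_def)

lemma depends_on_barrier_upto: "depends_on (\<lambda>\<omega>. barrier_upto J \<omega> c) {c - int J..c + int J}"
  unfolding depends_on_def
proof (intro allI impI)
  fix \<omega> \<omega>' :: "int \<Rightarrow> site"
  assume eq: "\<forall>x\<in>{c - int J..c + int J}. \<omega> x = \<omega>' x"
  have "surplus \<omega> I = surplus \<omega>' I" if "I \<subseteq> {c - int J..c + int J}" for I
    using that eq unfolding surplus_def by (intro sum.cong) (auto simp: st_def)
  moreover have "st \<omega> c = st \<omega>' c" using eq by (simp add: st_def)
  ultimately show "barrier_upto J \<omega> c = barrier_upto J \<omega>' c"
    by (simp add: barrier_upto_def subset_iff)
qed

definition trinomial :: "real \<Rightarrow> real \<Rightarrow> real \<Rightarrow> nat \<Rightarrow> nat \<Rightarrow> nat \<Rightarrow> real" where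
  "trinomial x y z a b c = fact (a + b + c) / (fact a * fact b * fact c) * x ^ a * y ^ b * z ^ c"

lemma trinomial_rec:
  assumes "a + b + c = Suc n"
  shows "trinomial x y z a b c = (if a = 0 then 0 else x * trinomial x y z (a - 1) b c) +
    (if b = 0 then 0 else y * trinomial x y z a (b - 1) c) +
    (if c = 0 then 0 else z * trinomial x y z a b (c - 1))"
proof -
  \<comment> \<open>The common factor of the recursion: the left-hand side is
    \<open>a + b + c\<close> times \<open>T\<close>, and the three summands on the right are
    \<open>a\<close>, \<open>b\<close> and \<open>c\<close> times \<open>T\<close>.\<close>
  define T where "T = fact n / (fact a * fact b * fact c) * x ^ a * y ^ b * z ^ c"
  have "real a + real b + real c = real (Suc n)" using assms by linarith
  then have "trinomial x y z a b c = (real a + real b + real c) * T"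
    using assms by (simp add: T_def trinomial_def)
  moreover have "(if a = 0 then 0 else x * trinomial x y z (a - 1) b c) = real a * T"
  proof (cases a)
    case (Suc a')
    then have "a' + b + c = n" using assms by simp
    then show ?thesis using Suc by (simp add: T_def trinomial_def field_simps del: of_nat_Suc)
  qed simp
  moreover have "(if b = 0 then 0 else y * trinomial x y z a (b - 1) c) = real b * T"
  proof (cases b)
    case (Suc b')
    then have "a + b' + c = n" using assms by simp
    then show ?thesis using Suc by (simp add: T_def trinomial_def field_simps del: of_nat_Suc)
  qed simp
  moreover have "(if c = 0 then 0 else z * trinomial x y z a b (c - 1)) = real c * T"
  proof (cases c)
    case (Suc c')
    then have "a + b + c' = n" using assms by simp
    then show ?thesis using Suc by (simp add: T_def trinomial_def field_simps del: of_nat_Suc)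
  qed simp
  ultimately show ?thesis by (simp only: distrib_right)
qed

section \<open>The random golf process\<close>

lemma distr_pair_snd:
  assumes "prob_space M" "prob_space M'"
  shows "distr (M \<Otimes>\<^sub>M M') M' snd = M'"
proof (rule measure_eqI)
  interpret M: prob_space M by fact
  interpret M': prob_space M' by fact
  fix A assume "A \<in> sets (distr (M \<Otimes>\<^sub>M M') M' snd)"
  then have A: "A \<in> sets M'" by simp
  then have "snd -` A \<inter> space (M \<Otimes>\<^sub>M M') = space M \<times> A"
    using sets.sets_into_space by (auto simp: space_pair_measure)
  then show "emeasure (distr (M \<Otimes>\<^sub>M M') M' snd) A = emeasure M' A"
    using A by (simp add: emeasure_distr M'.emeasure_pair_measure_Times M.emeasure_space_1)
qed simp

text \<open>During \<open>M\<close> equal steps the walk moves through \<open>M\<close> successive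
  sites in one direction and so meets every residue class modulo \<open>M\<close>.\<close>

lemma steps_run_covers:
  fixes s :: "nat \<Rightarrow> bool" and M :: nat
  assumes "0 < M" "\<And>r. r < M \<Longrightarrow> s (k + r) = v" "y \<in> {0..<int M}"
  shows "\<exists>k. (x + (\<Sum>i<k. if s i then 1 else - 1)) mod int M = y"
proof -
  define e :: int where "e = (if v then 1 else - 1)"
  define z where "z = x + (\<Sum>i<k. if s i then 1 else - 1 :: int)"
  have pos: "x + (\<Sum>i<k + r. if s i then 1 else - 1 :: int) = z + e * int r" if "r \<le> M" for r
    using that
  proof (induction r)
    case (Suc r)
    then show ?case using assms(2)[of r] by (simp add: e_def algebra_simps)
  qed (simp add: z_def)
  \<comment> \<open>Solves \<open>z + e * r = y\<close> modulo \<open>M\<close>; the sign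
    \<open>e\<close> is its own inverse.\<close>
  define r where "r = nat (e * (y - z) mod int M)"
  have r: "int r = e * (y - z) mod int M" using assms(1) by (simp add: r_def)
  then have "int r < int M" using assms(1) by simp
  then have "x + (\<Sum>i<k + r. if s i then 1 else - 1 :: int) = z + e * int r" by (intro pos) simp
  also have "(z + e * int r) mod int M = (z + e * (e * (y - z))) mod int M"
    unfolding r by (metis mod_add_right_eq mod_mult_right_eq)
  also have "z + e * (e * (y - z)) = y" by (simp add: e_def)
  also have "y mod int M = y" using assms(3) by simp
  finally show ?thesis by blast
qed

locale golf =
  fixes p rb rh :: real
  assumes rb_pos: "0 < rb" and rb_less_rh: "rb < rh" and rb_rh: "rb + rh \<le> 1"
    and p_nonneg: "0 \<le> p" and p_le: "p \<le> 1"
begin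

abbreviation "states \<equiv> measure_pmf (state_pmf rb rh)"
abbreviation "clocks \<equiv> uniform_measure lborel {0..1::real}"
abbreviation "walks \<equiv> walk_measure p"

lemma pmf_state: "pmf (state_pmf rb rh) Ball = rb" "pmf (state_pmf rb rh) Hole = rh"
  "pmf (state_pmf rb rh) Neutral = 1 - rb - rh"
proof -
  have "pmf_of_list_wf [(Ball, rb), (Hole, rh), (Neutral, 1 - rb - rh)]"
    using rb_pos rb_less_rh rb_rh by (auto simp: pmf_of_list_wf_def)
  then show "pmf (state_pmf rb rh) Ball = rb" "pmf (state_pmf rb rh) Hole = rh"
    "pmf (state_pmf rb rh) Neutral = 1 - rb - rh"
    by (simp_all add: state_pmf_def pmf_pmf_of_list)
qed

lemma prob_space_clocks: "prob_space clocks"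
  by (rule prob_space_uniform_measure) simp_all

sublocale steps: iid_space "measure_pmf (bernoulli_pmf p)" "TYPE(nat)"
  rewrites "steps.N = walks"
  by (rule iid_space.intro) (simp_all add: walk_measure_def prob_space_measure_pmf)

lemma prob_space_clock_walk: "prob_space (clocks \<Otimes>\<^sub>M walks)"
  by (intro prob_space_pair prob_space_clocks steps.prob_space_axioms)

sublocale iid_space "site_measure p rb rh" "TYPE(int)"
proof (rule iid_space.intro)
  show "prob_space (site_measure p rb rh)"
    unfolding site_measure_def by (intro prob_space_pair prob_space_measure_pmf prob_space_clock_walk)
  show "space (site_measure p rb rh) = UNIV"
    by (simp add: site_measure_def space_pair_measure)
qed

lemma golf_space_eq: "golf_space p rb rh = N"
  by (simp add: golf_space_def)

section \<open>Marginal laws and almost sure properties of clocks and walks\<close>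

lemma measurable_st_states: "(\<lambda>\<omega>. st \<omega> x) \<in> N \<rightarrow>\<^sub>M states"
  and measurable_clock_clocks: "(\<lambda>\<omega>. clock \<omega> x) \<in> N \<rightarrow>\<^sub>M clocks"
  and measurable_steps: "(\<lambda>\<omega>. steps \<omega> x) \<in> N \<rightarrow>\<^sub>M walks"
proof -
  have m: "(\<lambda>\<omega>. \<omega> x) \<in> N \<rightarrow>\<^sub>M states \<Otimes>\<^sub>M (clocks \<Otimes>\<^sub>M walks)"
    using measurable_component_singleton[of x UNIV "\<lambda>_. site_measure p rb rh"]
    by (simp add: site_measure_def)
  note m2 = measurable_compose[OF m measurable_snd]
  show "(\<lambda>\<omega>. st \<omega> x) \<in> N \<rightarrow>\<^sub>M states"
    unfolding st_def by (rule measurable_compose[OF m measurable_fst])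
  show "(\<lambda>\<omega>. clock \<omega> x) \<in> N \<rightarrow>\<^sub>M clocks"
    unfolding clock_def by (rule measurable_compose[OF m2 measurable_fst])
  show "(\<lambda>\<omega>. steps \<omega> x) \<in> N \<rightarrow>\<^sub>M walks"
    unfolding steps_def by (rule measurable_compose[OF m2 measurable_snd])
qed

lemma distr_st: "distr N states (\<lambda>\<omega>. st \<omega> x) = states"
  and distr_clock: "distr N clocks (\<lambda>\<omega>. clock \<omega> x) = clocks"
  and distr_steps: "distr N walks (\<lambda>\<omega>. steps \<omega> x) = walks"
proof -
  let ?T = "states \<Otimes>\<^sub>M (clocks \<Otimes>\<^sub>M walks)"
  interpret cw: prob_space "clocks \<Otimes>\<^sub>M walks" by (rule prob_space_clock_walk)
  have d: "distr N ?T (\<lambda>\<omega>. \<omega> x) = ?T"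
    using distr_coordinate[of x] by (simp add: site_measure_def)
  have m: "(\<lambda>\<omega>. \<omega> x) \<in> N \<rightarrow>\<^sub>M ?T"
    using measurable_component_singleton[of x UNIV "\<lambda>_. site_measure p rb rh"]
    by (simp add: site_measure_def)
  have snd: "distr ?T (clocks \<Otimes>\<^sub>M walks) snd = clocks \<Otimes>\<^sub>M walks"
    by (rule distr_pair_snd[OF prob_space_measure_pmf prob_space_clock_walk])
  have "distr N states (\<lambda>\<omega>. st \<omega> x) = distr (distr N ?T (\<lambda>\<omega>. \<omega> x)) states fst"
    using m by (subst distr_distr) (auto simp: comp_def st_def)
  also have "\<dots> = states"
    unfolding d by (rule cw.distr_pair_fst)
  finally show "distr N states (\<lambda>\<omega>. st \<omega> x) = states" .
  have "distr N clocks (\<lambda>\<omega>. clock \<omega> x) = distr (distr (distr N ?T (\<lambda>\<omega>. \<omega> x)) (clocks \<Otimes>\<^sub>M walks) snd) clocks fst"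
    using m by (subst distr_distr; (subst distr_distr)?) (auto simp: comp_def clock_def)
  also have "\<dots> = clocks"
    unfolding d snd by (rule steps.distr_pair_fst)
  finally show "distr N clocks (\<lambda>\<omega>. clock \<omega> x) = clocks" .
  have "distr N walks (\<lambda>\<omega>. steps \<omega> x) = distr (distr (distr N ?T (\<lambda>\<omega>. \<omega> x)) (clocks \<Otimes>\<^sub>M walks) snd) walks snd"
    using m by (subst distr_distr; (subst distr_distr)?) (auto simp: comp_def steps_def)
  also have "\<dots> = walks"
    unfolding d snd by (rule distr_pair_snd[OF prob_space_clocks steps.prob_space_axioms])
  finally show "distr N walks (\<lambda>\<omega>. steps \<omega> x) = walks" .
qed

lemma measurable_st [measurable]: "(\<lambda>\<omega>. st \<omega> x) \<in> N \<rightarrow>\<^sub>M count_space UNIV"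
  using measurable_st_states by simp

lemma measurable_clock [measurable]: "(\<lambda>\<omega>. clock \<omega> x) \<in> borel_measurable N"
proof -
  have "borel_measurable N = N \<rightarrow>\<^sub>M clocks" by (rule measurable_cong_sets) simp_all
  then show ?thesis using measurable_clock_clocks by simp
qed

lemma measurable_walks_step [measurable]: "(\<lambda>s. s k) \<in> walks \<rightarrow>\<^sub>M count_space UNIV"
proof -
  have "(\<lambda>s. s k) \<in> walks \<rightarrow>\<^sub>M measure_pmf (bernoulli_pmf p)"
    unfolding walk_measure_def by (rule measurable_component_singleton) simp
  then show ?thesis by simp
qed

lemma measurable_step [measurable]: "(\<lambda>\<omega>. steps \<omega> x k) \<in> N \<rightarrow>\<^sub>M count_space UNIV"
  by (rule measurable_compose[OF measurable_steps measurable_walks_step])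

lemma prob_st: "prob {\<omega>. st \<omega> x = s} = pmf (state_pmf rb rh) s"
proof -
  have "pmf (state_pmf rb rh) s = measure (distr N states (\<lambda>\<omega>. st \<omega> x)) {s}"
    by (simp add: distr_st measure_pmf_single)
  also have "\<dots> = prob {\<omega>. st \<omega> x = s}"
    using measure_distr[OF measurable_st_states, of "{s}"] by (simp add: vimage_def)
  finally show ?thesis ..
qed

lemma AE_clock_le: "AE \<omega> in N. \<forall>x. clock \<omega> x \<le> 1"
proof -
  have "AE t in clocks. t \<le> 1" by (rule AE_uniform_measureI) auto
  then have "AE t in distr N clocks (\<lambda>\<omega>. clock \<omega> x). t \<le> 1" for x by (subst distr_clock)
  then have "AE \<omega> in N. clock \<omega> x \<le> 1" for x by (rule AE_distrD[OF measurable_clock_clocks])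
  then show ?thesis by (simp add: AE_all_countable)
qed

lemma AE_clock_inj: "AE \<omega> in N. inj (clock \<omega>)"
proof -
  interpret clocks: prob_space clocks by (rule prob_space_clocks)
  interpret cc: pair_sigma_finite clocks clocks ..
  have cc: "AE z in clocks \<Otimes>\<^sub>M clocks. fst z \<noteq> snd z"
  proof (rule cc.AE_pair_measure)
    have "(\<lambda>z. fst z \<noteq> snd z) \<in> borel \<Otimes>\<^sub>M (borel :: real measure) \<rightarrow>\<^sub>M count_space UNIV"
      by measurable
    moreover have "sets (clocks \<Otimes>\<^sub>M clocks) = sets (borel \<Otimes>\<^sub>M borel)"
      by (rule sets_pair_measure_cong) simp_all
    ultimately have "Measurable.pred (clocks \<Otimes>\<^sub>M clocks) (\<lambda>z. fst z \<noteq> snd z)"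
      using measurable_cong_sets by blast
    then show "{z \<in> space (clocks \<Otimes>\<^sub>M clocks). fst z \<noteq> snd z} \<in> sets (clocks \<Otimes>\<^sub>M clocks)"
      by (simp add: pred_def)
    have "AE t in clocks. c \<noteq> t" for c
      by (rule AE_uniform_measureI) (use AE_lborel_singleton[of c] in \<open>auto elim: AE_mp\<close>)
    then show "AE x in clocks. AE y in clocks. fst (x, y) \<noteq> snd (x, y)" by simp
  qed
  have "AE \<omega> in N. clock \<omega> x \<noteq> clock \<omega> y" if "x \<noteq> y" for x y
  proof -
    have m: "(\<lambda>f. fst (snd (f z))) \<in> PiM {z} (\<lambda>_. site_measure p rb rh) \<rightarrow>\<^sub>M clocks" for z :: int
      unfolding site_measure_def by measurable
    have "indep_var (PiM {x} (\<lambda>_. site_measure p rb rh)) (\<lambda>\<omega>. restrict \<omega> {x})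
        (PiM {y} (\<lambda>_. site_measure p rb rh)) (\<lambda>\<omega>. restrict \<omega> {y})"
      using indep_var_restrict[OF indep_vars_coordinates, of "{x}" "{y}"] that by simp
    from indep_var_compose[OF this m m]
    have "indep_var clocks (\<lambda>\<omega>. clock \<omega> x) clocks (\<lambda>\<omega>. clock \<omega> y)"
      by (simp add: comp_def clock_def)
    then have d: "distr N (clocks \<Otimes>\<^sub>M clocks) (\<lambda>\<omega>. (clock \<omega> x, clock \<omega> y)) = clocks \<Otimes>\<^sub>M clocks"
      unfolding indep_var_distribution_eq by (simp add: distr_clock)
    have "AE z in distr N (clocks \<Otimes>\<^sub>M clocks) (\<lambda>\<omega>. (clock \<omega> x, clock \<omega> y)). fst z \<noteq> snd z"
      by (subst d) (rule cc)
    from AE_distrD[OF measurable_Pair[OF measurable_clock_clocks measurable_clock_clocks] this]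
    show ?thesis by simp
  qed
  then have "AE \<omega> in N. \<forall>x y. x \<noteq> y \<longrightarrow> clock \<omega> x \<noteq> clock \<omega> y"
    by (simp add: AE_all_countable)
  then show ?thesis by (rule AE_mp) (auto simp: inj_def)
qed

text \<open>In each of infinitely many disjoint blocks of \<open>M\<close> steps, all steps are
  equal to a fixed value with the same positive probability, so almost surely this happens in some
  block. The argument covers every \<open>p\<close>, including the deterministic walks.\<close>

lemma AE_walk_covers:
  fixes M :: nat
  assumes "0 < M"
  shows "AE \<omega> in N. \<forall>x. \<forall>y\<in>{0..<int M}. \<exists>k. walk \<omega> x k mod int M = y"
proof -
  \<comment> \<open>A step value of positive probability: for \<open>p = 0\<close> only the step to
    the left is possible.\<close>
  define v where "v \<longleftrightarrow> 0 < p"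
  define \<delta> where "\<delta> = pmf (bernoulli_pmf p) v ^ M"
  have v: "0 < pmf (bernoulli_pmf p) v"
    using p_nonneg p_le by (cases "0 < p") (auto simp: v_def)
  have "AE s in walks. \<exists>i. \<forall>r\<in>{i * M..<i * M + M}. s r \<in> {v}"
  proof (rule steps.AE_exists_disjoint[unfolded walk_measure_def[symmetric], where I = "\<lambda>i. {i * M..<i * M + M}"])
    show "depends_on (\<lambda>s. \<forall>r\<in>{i * M..<i * M + M}. s r \<in> {v}) {i * M..<i * M + M}" for i
      by (auto simp: depends_on_def)
    show "{i * M..<i * M + M} \<inter> {j * M..<j * M + M} = {}" if "i < j" for i j
    proof -
      have "Suc i * M \<le> j * M" using that by (intro mult_le_mono1) simp
      then show ?thesis by auto
    qed
    show "0 < \<delta>" using v by (simp add: \<delta>_def)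
    show "\<delta> \<le> 1" by (simp add: \<delta>_def power_le_one pmf_le_1)
    show "\<delta> \<le> steps.prob {s. \<forall>r\<in>{i * M..<i * M + M}. s r \<in> {v}}" for i
      using steps.prob_all_coordinates[of "{v}" "{i * M..<i * M + M}"]
      by (simp add: \<delta>_def measure_pmf_single)
    show "Measurable.pred walks (\<lambda>s. \<forall>r\<in>{i * M..<i * M + M}. s r \<in> {v})" for i
      by measurable
  qed
  then have "AE s in walks. \<forall>x. \<forall>y\<in>{0..<int M}. \<exists>k. (x + (\<Sum>i<k. if s i then 1 else - 1)) mod int M = y"
  proof (rule AE_mp, intro AE_I2 impI allI ballI)
    fix s x y assume "\<exists>i. \<forall>r\<in>{i * M..<i * M + M}. s r \<in> {v}" and y: "y \<in> {0..<int M}"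
    then obtain i where "\<forall>r\<in>{i * M..<i * M + M}. s r \<in> {v}" by blast
    then have "s (i * M + r) = v" if "r < M" for r using that by simp
    from steps_run_covers[where s = s and k = "i * M", OF assms this y]
    show "\<exists>k. (x + (\<Sum>i<k. if s i then 1 else - 1)) mod int M = y" .
  qed
  then have "AE s in distr N walks (\<lambda>\<omega>. steps \<omega> x'). \<forall>x. \<forall>y\<in>{0..<int M}. \<exists>k. (x + (\<Sum>i<k. if s i then 1 else - 1)) mod int M = y" for x'
    by (simp only: distr_steps)
  from AE_distrD[OF measurable_steps this]
  have "AE \<omega> in N. \<forall>x. \<forall>y\<in>{0..<int M}. \<exists>k. (x + (\<Sum>i<k. if steps \<omega> x' i then 1 else - 1)) mod int M = y" for x' .
  then have "AE \<omega> in N. \<forall>x'. \<forall>x. \<forall>y\<in>{0..<int M}. \<exists>k. (x + (\<Sum>i<k. if steps \<omega> x' i then 1 else - 1)) mod int M = y"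
    by (simp add: AE_all_countable)
  then show ?thesis by (rule AE_mp) (auto simp: walk_def)
qed

section \<open>Measurability of the process\<close>

lemma measurable_walk [measurable]: "(\<lambda>\<omega>. walk \<omega> x k) \<in> N \<rightarrow>\<^sub>M count_space UNIV"
proof -
  have "(\<lambda>\<omega>. \<Sum>i<k. if steps \<omega> x i then 1 else - 1 :: int) \<in> N \<rightarrow>\<^sub>M count_space UNIV"
  proof (induction k)
    case (Suc k)
    have "(\<lambda>\<omega>. (if steps \<omega> x k then 1 else - 1 :: int)) \<in> N \<rightarrow>\<^sub>M count_space UNIV"
      by measurable
    then have "(\<lambda>\<omega>. i + (if steps \<omega> x k then 1 else - 1 :: int)) \<in> N \<rightarrow>\<^sub>M count_space UNIV" for i
      by (rule measurable_compose) simp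
    from measurable_compose_countable[OF this Suc.IH] show ?case by simp
  qed simp
  from measurable_compose[OF this, of "\<lambda>d. x + d"] show ?thesis by (simp add: walk_def)
qed

lemma measurable_surplus [measurable]:
  assumes "finite I"
  shows "(\<lambda>\<omega>. surplus \<omega> I) \<in> N \<rightarrow>\<^sub>M count_space UNIV"
  using assms
proof (induction I)
  case (insert x I)
  have "(\<lambda>\<omega>. weight (st \<omega> x)) \<in> N \<rightarrow>\<^sub>M count_space UNIV"
    by (rule measurable_compose[OF measurable_st]) simp
  then have "(\<lambda>\<omega>. weight (st \<omega> x) + i) \<in> N \<rightarrow>\<^sub>M count_space UNIV" for i
    by (rule measurable_compose) simp
  from measurable_compose_countable[OF this insert.IH] show ?case
    using insert.hyps by (simp add: surplus_def)
qed (simp add: surplus_def)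

lemma measurable_balls_in [measurable]: "(\<lambda>\<omega>. balls_in \<omega> i j) \<in> N \<rightarrow>\<^sub>M count_space UNIV"
proof -
  have insort: "(\<lambda>\<omega>. insort_key (clock \<omega>) x xs) \<in> N \<rightarrow>\<^sub>M count_space UNIV" for x xs
  proof (induction xs)
    case (Cons y xs)
    have "(\<lambda>\<omega>. y # insort_key (clock \<omega>) x xs) \<in> N \<rightarrow>\<^sub>M count_space UNIV"
      by (rule measurable_compose[OF Cons.IH]) simp
    then show ?case by simp
  qed simp
  have sort: "(\<lambda>\<omega>. sort_key (clock \<omega>) xs) \<in> N \<rightarrow>\<^sub>M count_space UNIV" for xs
  proof (induction xs)
    case (Cons x xs)
    from measurable_compose_countable[OF insort Cons.IH] show ?case by simp
  qed simp
  have filter: "(\<lambda>\<omega>. filter (\<lambda>x. st \<omega> x = Ball \<and> clock \<omega> x \<le> 1) xs) \<in> N \<rightarrow>\<^sub>M count_space UNIV" for xs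
  proof (induction xs)
    case (Cons x xs)
    have "(\<lambda>\<omega>. x # filter (\<lambda>x. st \<omega> x = Ball \<and> clock \<omega> x \<le> 1) xs) \<in> N \<rightarrow>\<^sub>M count_space UNIV"
      by (rule measurable_compose[OF Cons.IH]) simp
    moreover have "Measurable.pred N (\<lambda>\<omega>. st \<omega> x = Ball \<and> clock \<omega> x \<le> 1)" by measurable
    ultimately show ?case using Cons.IH by simp
  qed simp
  from measurable_compose_countable[OF sort filter] show ?thesis by (simp add: balls_in_def)
qed

lemma measurable_move:
  assumes "finite W" "G \<in> Pow W"
  shows "(\<lambda>\<omega>. move (\<lambda>x k. \<psi> (walk \<omega> x k)) G x) \<in> N \<rightarrow>\<^sub>M count_space (Pow W)"
proof -
  have m [measurable]: "(\<lambda>\<omega>. \<psi> (walk \<omega> x k)) \<in> N \<rightarrow>\<^sub>M count_space UNIV" for k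
    by (rule measurable_compose[OF measurable_walk]) simp
  have L: "(\<lambda>\<omega>. LEAST k. \<psi> (walk \<omega> x k) \<in> G) \<in> N \<rightarrow>\<^sub>M count_space UNIV"
    by measurable
  from measurable_compose_countable[OF m L]
  have "(\<lambda>\<omega>. \<psi> (walk \<omega> x (LEAST k. \<psi> (walk \<omega> x k) \<in> G))) \<in> N \<rightarrow>\<^sub>M count_space UNIV" .
  then have "(\<lambda>\<omega>. G - {\<psi> (walk \<omega> x (LEAST k. \<psi> (walk \<omega> x k) \<in> G))}) \<in> N \<rightarrow>\<^sub>M count_space (Pow W)"
    by (rule measurable_compose) (use assms in auto)
  moreover have "Measurable.pred N (\<lambda>\<omega>. \<exists>k. \<psi> (walk \<omega> x k) \<in> G)" by measurable
  moreover have "(\<lambda>_. G) \<in> N \<rightarrow>\<^sub>M count_space (Pow W)" using assms by simp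
  ultimately show ?thesis
    unfolding move_def by (intro measurable_If) (auto simp: pred_def)
qed

text \<open>Composition with a random argument works when that argument has countably many values.
  The type \<open>int set\<close> is uncountable, so the target is cut down to the subsets of a
  fixed finite set; the random list of balls is harmless because there are only countably many
  lists.\<close>

lemma measurable_final:
  assumes "finite F"
  shows "(\<lambda>\<omega>. final \<psi> \<omega> i j F) \<in> N \<rightarrow>\<^sub>M count_space (Pow (F \<union> {i..j}))"
proof -
  let ?W = "F \<union> {i..j}" and ?w = "\<lambda>\<omega> x k. \<psi> (walk \<omega> x k)"
  have fin: "finite ?W" "countable (Pow ?W)" using assms by (auto intro: countable_finite)
  have "F \<union> {x \<in> set xs. st \<omega> x = Hole} \<in> Pow (F \<union> set xs)" for xs \<omega> by auto
  have holes: "(\<lambda>\<omega>. F \<union> {x \<in> set xs. st \<omega> x = Hole}) \<in> N \<rightarrow>\<^sub>M count_space (Pow ?W)" if "set xs \<subseteq> {i..j}" for xs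
    using that
  proof (induction xs)
    case (Cons x xs)
    have "insert x \<in> count_space (Pow ?W) \<rightarrow>\<^sub>M count_space (Pow ?W)"
      using Cons.prems by auto
    from measurable_compose[OF Cons.IH this]
    have "(\<lambda>\<omega>. insert x (F \<union> {x \<in> set xs. st \<omega> x = Hole})) \<in> N \<rightarrow>\<^sub>M count_space (Pow ?W)"
      using Cons.prems by simp
    moreover have "Measurable.pred N (\<lambda>\<omega>. st \<omega> x = Hole)" by measurable
    moreover have "(\<lambda>\<omega>. F \<union> {x \<in> set xs. st \<omega> x = Hole}) \<in> N \<rightarrow>\<^sub>M count_space (Pow ?W)"
      using Cons by simp
    ultimately have "(\<lambda>\<omega>. if st \<omega> x = Hole then insert x (F \<union> {x \<in> set xs. st \<omega> x = Hole})
        else F \<union> {x \<in> set xs. st \<omega> x = Hole}) \<in> N \<rightarrow>\<^sub>M count_space (Pow ?W)"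
      by (intro measurable_If) (auto simp: pred_def)
    also have "(\<lambda>\<omega>. if st \<omega> x = Hole then insert x (F \<union> {x \<in> set xs. st \<omega> x = Hole})
        else F \<union> {x \<in> set xs. st \<omega> x = Hole}) = (\<lambda>\<omega>. F \<union> {y \<in> set (x # xs). st \<omega> y = Hole})"
      by (intro ext) auto
    finally show ?case .
  qed simp
  have run: "(\<lambda>\<omega>. run (?w \<omega>) (G \<omega>) L) \<in> N \<rightarrow>\<^sub>M count_space (Pow ?W)"
    if "G \<in> N \<rightarrow>\<^sub>M count_space (Pow ?W)" for G L
    using that
  proof (induction L arbitrary: G)
    case (Cons x L)
    from measurable_compose_countable'[OF measurable_move[OF fin(1)] Cons.prems fin(2)]
    have "(\<lambda>\<omega>. move (?w \<omega>) (G \<omega>) x) \<in> N \<rightarrow>\<^sub>M count_space (Pow ?W)" .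
    from Cons.IH[OF this] show ?case by simp
  qed simp
  have "(\<lambda>\<omega>. F \<union> holes_in \<omega> i j) \<in> N \<rightarrow>\<^sub>M count_space (Pow ?W)"
    using holes[of "[i..j]"] by (simp add: holes_in_def)
  from measurable_compose_countable[OF run[OF this] measurable_balls_in[of i j]]
  show ?thesis unfolding final_def .
qed

lemma pred_final:
  assumes "finite F"
  shows "Measurable.pred N (\<lambda>\<omega>. P (final \<psi> \<omega> i j F))"
  by (rule measurable_compose[OF measurable_final[OF assms]]) simp

lemma prob_shift:
  assumes "Measurable.pred N P"
  shows "prob {\<omega>. P (\<omega> \<circ> (\<lambda>x. x + s))} = prob {\<omega>. P \<omega>}"
  by (rule prob_reindex) (simp_all add: assms inj_def)

subsection \<open>The law of the surplus\<close>

definition rn :: real where "rn = 1 - rb - rh"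

lemma rn_nonneg: "0 \<le> rn"
  using rb_rh by (simp add: rn_def)

text \<open>Conditioning on the state of one site that is independent of the rest. The recursions
  for the surplus, for its tail bound and for the counts of the three states all come from
  here.\<close>

lemma prob_site_split:
  assumes R: "\<And>s. Measurable.pred N (R s)" "\<And>s. depends_on (R s) I" and "x \<notin> I"
  shows "prob {\<omega>. R (st \<omega> x) \<omega>} = rb * prob {\<omega>. R Ball \<omega>} + rh * prob {\<omega>. R Hole \<omega>} + rn * prob {\<omega>. R Neutral \<omega>}"
proof -
  define A where "A s = {\<omega>. st \<omega> x = s \<and> R s \<omega>}" for s
  have UNIV: "(UNIV :: site_state set) = {Ball, Hole, Neutral}"
    using site_state.exhaust by blast
  have m: "Measurable.pred N (\<lambda>\<omega>. st \<omega> x = s)" for s by measurable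
  have "A s \<in> events" for s
    unfolding A_def by (rule pred_sets_N) (intro pred_intros_logic m R)
  then have "prob (\<Union>s\<in>UNIV. A s) = (\<Sum>s\<in>UNIV. prob (A s))"
    by (intro finite_measure_finite_Union) (auto simp: UNIV A_def disjoint_family_on_def)
  also have "(\<Union>s\<in>UNIV. A s) = {\<omega>. R (st \<omega> x) \<omega>}" by (auto simp: A_def)
  finally have sum: "prob {\<omega>. R (st \<omega> x) \<omega>} = (\<Sum>s\<in>UNIV. prob (A s))" .
  have "prob (A s) = pmf (state_pmf rb rh) s * prob {\<omega>. R s \<omega>}" for s
    unfolding A_def prob_st[of x s, symmetric]
    by (rule prob_conj_disjoint[OF m depends_on_st R]) (use assms in auto)
  then show ?thesis unfolding sum by (simp add: UNIV pmf_state rn_def)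
qed

lemma pred_surplus: "finite I \<Longrightarrow> Measurable.pred N (\<lambda>\<omega>. P (surplus \<omega> I))"
  by (rule measurable_compose[OF measurable_surplus]) simp_all

lemma prob_surplus_insert:
  assumes "finite I" "x \<notin> I"
  shows "prob {\<omega>. P (surplus \<omega> (insert x I))} = rb * prob {\<omega>. P (surplus \<omega> I - 1)} +
    rh * prob {\<omega>. P (surplus \<omega> I + 1)} + rn * prob {\<omega>. P (surplus \<omega> I)}"
proof -
  have "prob {\<omega>. P (weight (st \<omega> x) + surplus \<omega> I)} = rb * prob {\<omega>. P (weight Ball + surplus \<omega> I)} +
    rh * prob {\<omega>. P (weight Hole + surplus \<omega> I)} + rn * prob {\<omega>. P (weight Neutral + surplus \<omega> I)}"
    by (rule prob_site_split[of "\<lambda>s \<omega>. P (weight s + surplus \<omega> I)", OF pred_surplus depends_on_surplus])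
      (use assms in auto)
  then show ?thesis using assms by (simp add: surplus_insert add.commute)
qed

text \<open>The distribution after \<open>n\<close> steps of the lazy random walk with steps
  \<open>1\<close>, \<open>- 1\<close> and \<open>0\<close> of probabilities \<open>rh\<close>,
  \<open>rb\<close> and \<open>rn\<close>.\<close>

primrec law :: "nat \<Rightarrow> int \<Rightarrow> real" where
  "law 0 k = of_bool (k = 0)"
| "law (Suc n) k = rb * law n (k + 1) + rh * law n (k - 1) + rn * law n k"

lemma prob_surplus:
  assumes "finite I"
  shows "prob {\<omega>. surplus \<omega> I = k} = law (card I) k"
  using assms
proof (induction I arbitrary: k)
  case empty
  then show ?case by (cases "k = 0") (auto simp: surplus_def prob_space)
next
  case (insert x I)
  have "{\<omega>. surplus \<omega> I - 1 = k} = {\<omega>. surplus \<omega> I = k + 1}" "{\<omega>. surplus \<omega> I + 1 = k} = {\<omega>. surplus \<omega> I = k - 1}"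
    by auto
  then show ?case
    using insert prob_surplus_insert[OF insert.hyps, of "\<lambda>j. j = k"] by simp
qed

text \<open>The minimiser over positive \<open>z\<close> of \<open>rb / z + rh * z + rn\<close>. The
  minimum \<open>theta\<close> equals \<open>1 - (sqrt rh - sqrt rb)^2\<close>, which is below 1
  because \<open>rb\<close> and \<open>rh\<close> differ.\<close>

definition zeta :: real where "zeta = sqrt (rb / rh)"
definition theta :: real where "theta = rb / zeta + rh * zeta + rn"

lemma zeta: "0 < zeta" "zeta < 1"
  using rb_pos rb_less_rh by (auto simp: zeta_def)

lemma theta: "0 < theta" "theta < 1"
proof -
  have rh: "0 < rh" using rb_pos rb_less_rh by simp
  show "0 < theta"
    unfolding theta_def using rb_pos rh zeta rn_nonneg by (intro add_pos_nonneg add_pos_pos) auto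
  have z2: "zeta\<^sup>2 = rb / rh" using rb_pos rh by (simp add: zeta_def)
  then have rbz: "rb = rh * zeta\<^sup>2" using rh by simp
  have "rb / zeta = rh * zeta" using zeta rbz by (subst divide_eq_eq) (simp add: power2_eq_square)
  then have "1 - theta = rh * (1 - zeta)\<^sup>2"
    unfolding theta_def rn_def using rbz by (simp add: power2_diff algebra_simps)
  moreover have "0 < rh * (1 - zeta)\<^sup>2" using rh zeta by simp
  ultimately show "theta < 1" by linarith
qed

text \<open>Chernoff bound: \<open>theta\<close> is the expectation of \<open>zeta\<close> to the power of the weight of a site.\<close>
lemma prob_surplus_le:
  assumes "finite I"
  shows "prob {\<omega>. surplus \<omega> I \<le> k} \<le> theta ^ card I * zeta powi (- k)"
  using assms
proof (induction I arbitrary: k)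
  case empty
  show ?case
  proof (cases "0 \<le> k")
    case True
    have "zeta ^ nat k \<le> 1" using zeta by (intro power_le_one) auto
    then have "1 \<le> zeta powi (- k)"
      using True zeta by (simp add: power_int_minus power_int_def one_le_inverse)
    then show ?thesis using True by (simp add: surplus_def prob_space)
  next
    case False
    then show ?thesis using zeta by (simp add: surplus_def)
  qed
next
  case (insert x I)
  let ?t = "theta ^ card I" and ?z = "zeta powi (- k)"
  have "prob {\<omega>. surplus \<omega> (insert x I) \<le> k} = rb * prob {\<omega>. surplus \<omega> I \<le> k + 1} +
      rh * prob {\<omega>. surplus \<omega> I \<le> k - 1} + rn * prob {\<omega>. surplus \<omega> I \<le> k}"
  proof -
    have "{\<omega>. surplus \<omega> I - 1 \<le> k} = {\<omega>. surplus \<omega> I \<le> k + 1}" "{\<omega>. surplus \<omega> I + 1 \<le> k} = {\<omega>. surplus \<omega> I \<le> k - 1}"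
      by auto
    then show ?thesis using prob_surplus_insert[OF insert.hyps, of "\<lambda>j. j \<le> k"] by simp
  qed
  also have "\<dots> \<le> rb * (?t * zeta powi (- (k + 1))) + rh * (?t * zeta powi (- (k - 1))) + rn * (?t * ?z)"
    using rb_pos rb_less_rh rn_nonneg by (intro add_mono mult_left_mono insert.IH) auto
  also have "zeta powi (- (k + 1)) = ?z / zeta"
    using zeta power_int_add[of zeta "- k" "- 1"] by (simp add: power_int_minus field_simps)
  also have "zeta powi (- (k - 1)) = ?z * zeta"
    using zeta power_int_add[of zeta "- k" 1] by (simp add: algebra_simps)
  also have "rb * (?t * (?z / zeta)) + rh * (?t * (?z * zeta)) + rn * (?t * ?z) = theta ^ card (insert x I) * ?z"
    using insert.hyps by (simp add: theta_def algebra_simps)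
  finally show ?case .
qed

text \<open>Exchanging balls and holes in a configuration with surplus \<open>k\<close> gives one
  with surplus \<open>- k\<close> and multiplies its probability by
  \<open>(rb / rh) powi k\<close>.\<close>

lemma law_reflect: "law n (- k) = (rb / rh) powi k * law n k"
proof (induction n arbitrary: k)
  case (Suc n)
  let ?r = "rb / rh"
  have r: "?r \<noteq> 0" using rb_pos rb_less_rh by simp
  have e: "?r powi (k - 1) = ?r powi k * (rh / rb)" "?r powi (k + 1) = ?r powi k * (rb / rh)"
    using r by (simp_all add: power_int_add power_int_diff)
  have "law (Suc n) (- k) = rb * law n (- (k - 1)) + rh * law n (- (k + 1)) + rn * law n (- k)"
  proof -
    have "- k + 1 = - (k - 1)" "- k - 1 = - (k + 1)" by simp_all
    then show ?thesis by (simp only: law.simps)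
  qed
  also have "\<dots> = rb * (?r powi k * (rh / rb) * law n (k - 1)) + rh * (?r powi k * (rb / rh) * law n (k + 1)) + rn * (?r powi k * law n k)"
    by (simp only: Suc.IH e)
  also have "\<dots> = ?r powi k * law (Suc n) k"
    using rb_pos rb_less_rh by (simp add: field_simps)
  finally show ?case .
qed simp

text \<open>The probabilities of a surplus at least 1 and at least 0 telescope to 1 and 0; together with
  the reflection identity this determines the expected number of visits to level 1.\<close>
lemma law_sums: "(\<lambda>n. law (Suc n) 1) sums (1 / (rh - rb))"
proof -
  define t where "t k n = prob {\<omega>. k \<le> surplus \<omega> {0..<int n}}" for k n
  \<comment> \<open>A new site lifts the surplus to level \<open>k\<close> only from
    \<open>k - 1\<close>, by a hole, and takes it below level \<open>k\<close> only from
    \<open>k\<close>, by a ball.\<close>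
  have step: "t k (Suc n) - t k n = rh * law n (k - 1) - rb * law n k" for k n
  proof -
    let ?S = "\<lambda>\<omega>. surplus \<omega> {0..<int n}"
    have ins: "{0..<int (Suc n)} = insert (int n) {0..<int n}" by auto
    have rec: "t k (Suc n) = rb * prob {\<omega>. k \<le> ?S \<omega> - 1} + rh * prob {\<omega>. k \<le> ?S \<omega> + 1} + rn * t k n"
      unfolding t_def ins by (rule prob_surplus_insert) auto
    have split: "prob {\<omega>. j \<le> ?S \<omega>} = prob {\<omega>. j + 1 \<le> ?S \<omega>} + law n j" for j
    proof -
      have "{\<omega>. j \<le> ?S \<omega>} = {\<omega>. j + 1 \<le> ?S \<omega>} \<union> {\<omega>. ?S \<omega> = j}" by auto
      then have "prob {\<omega>. j \<le> ?S \<omega>} = prob {\<omega>. j + 1 \<le> ?S \<omega>} + prob {\<omega>. ?S \<omega> = j}"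
        by (simp only:, intro finite_measure_Union pred_sets_N pred_surplus) auto
      then show ?thesis by (simp add: prob_surplus)
    qed
    have "prob {\<omega>. k \<le> ?S \<omega> - 1} = t k n - law n k"
    proof -
      have "{\<omega>. k \<le> ?S \<omega> - 1} = {\<omega>. k + 1 \<le> ?S \<omega>}" by auto
      then show ?thesis using split[of k] by (simp add: t_def)
    qed
    moreover have "prob {\<omega>. k \<le> ?S \<omega> + 1} = t k n + law n (k - 1)"
    proof -
      have "{\<omega>. k \<le> ?S \<omega> + 1} = {\<omega>. k - 1 \<le> ?S \<omega>}" by auto
      then show ?thesis using split[of "k - 1"] by (simp add: t_def)
    qed
    ultimately have "t k (Suc n) = rb * (t k n - law n k) + rh * (t k n + law n (k - 1)) + rn * t k n"
      by (simp only: rec)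
    then show ?thesis by (simp add: rn_def algebra_simps)
  qed
  have lim: "t k \<longlonglongrightarrow> 1" for k
  proof (rule tendsto_sandwich)
    have "1 - theta ^ n * zeta powi (- (k - 1)) \<le> t k n" for n
    proof -
      have "{\<omega>. k \<le> surplus \<omega> {0..<int n}} = {\<omega>. \<not> surplus \<omega> {0..<int n} \<le> k - 1}" by auto
      then have "t k n = 1 - prob {\<omega>. surplus \<omega> {0..<int n} \<le> k - 1}"
        unfolding t_def using prob_neg[of "\<lambda>\<omega>. surplus \<omega> {0..<int n} \<le> k - 1"]
        by (simp add: pred_sets_N pred_surplus)
      then show ?thesis using prob_surplus_le[of "{0..<int n}" "k - 1"] by simp
    qed
    then show "\<forall>\<^sub>F n in sequentially. 1 - theta ^ n * zeta powi (- (k - 1)) \<le> t k n" by simp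
    show "\<forall>\<^sub>F n in sequentially. t k n \<le> 1" by (simp add: t_def)
    have "(\<lambda>n. 1 - theta ^ n * zeta powi (- (k - 1))) \<longlonglongrightarrow> 1 - 0 * zeta powi (- (k - 1))"
      using theta by (intro tendsto_intros LIMSEQ_realpow_zero) auto
    then show "(\<lambda>n. 1 - theta ^ n * zeta powi (- (k - 1))) \<longlonglongrightarrow> 1" by simp
  qed simp
  have sums: "(\<lambda>n. rh * law n (k - 1) - rb * law n k) sums (1 - t k 0)" for k
  proof -
    have "(\<lambda>n. t k (Suc n) - t k n) sums (1 - t k 0)"
      by (rule telescope_sums[OF lim])
    then show ?thesis by (simp only: step)
  qed
  have t0: "t 1 0 = 0" "t 0 0 = 1"
    by (simp_all add: t_def surplus_def prob_space)
  have refl: "rh * law n (- 1) = rb * law n 1" for n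
    using law_reflect[of n 1] rb_pos rb_less_rh by simp
  \<comment> \<open>The series for levels 1 and 0 have sums 1 and 0. After reflection both involve
    only \<open>law n 0\<close> and \<open>law n 1\<close>; the factor \<open>rh / rb\<close> is
    chosen so that \<open>law n 0\<close> cancels.\<close>
  have "(\<lambda>n. (rh * law n 0 - rb * law n 1) + rh / rb * (rb * law n 1 - rb * law n 0)) sums (1 + rh / rb * 0)"
    using sums[of 1] sums[of 0] by (intro sums_add sums_mult) (simp_all add: t0 refl)
  also have "(\<lambda>n. (rh * law n 0 - rb * law n 1) + rh / rb * (rb * law n 1 - rb * law n 0)) = (\<lambda>n. (rh - rb) * law n 1)"
    using rb_pos by (intro ext) (simp add: field_simps)
  finally have "(\<lambda>n. (rh - rb) * law n 1 / (rh - rb)) sums (1 / (rh - rb))"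
    by (intro sums_divide) simp
  then have "(\<lambda>n. law n 1) sums (1 / (rh - rb))" using rb_less_rh by simp
  \<comment> \<open>The term \<open>law 0 1\<close> is zero, so the sum may start at one
    step.\<close>
  then show ?thesis by (subst sums_Suc_iff) simp
qed

section \<open>The law at level 1 as a sum of trinomial probabilities\<close>

lemma measurable_count [measurable]: "finite I \<Longrightarrow> (\<lambda>\<omega>. site_count \<omega> I s) \<in> N \<rightarrow>\<^sub>M count_space UNIV"
proof (induction I rule: finite_induct)
  case (insert x I)
  have "Measurable.pred N (\<lambda>\<omega>. st \<omega> x = s)" by measurable
  then have "(\<lambda>\<omega>. i + of_bool (st \<omega> x = s) :: nat) \<in> N \<rightarrow>\<^sub>M count_space UNIV" for i
    by (rule measurable_compose) simp
  from measurable_compose_countable[OF this insert.IH] show ?case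
    using insert.hyps by (simp add: site_count_insert)
qed (simp add: site_count_def)

lemma prob_count:
  assumes "finite I" "a + b + c = card I"
  shows "prob {\<omega>. site_count \<omega> I Ball = a \<and> site_count \<omega> I Hole = b \<and> site_count \<omega> I Neutral = c} = trinomial rb rh rn a b c"
  using assms
proof (induction I arbitrary: a b c)
  case empty
  then show ?case by (simp add: site_count_def trinomial_def prob_space)
next
  case (insert x I)
  let ?E = "\<lambda>a b c \<omega>. site_count \<omega> I Ball = a \<and> site_count \<omega> I Hole = b \<and> site_count \<omega> I Neutral = c"
  define R where "R s \<omega> \<longleftrightarrow> site_count \<omega> I Ball + of_bool (s = Ball) = a \<and>
    site_count \<omega> I Hole + of_bool (s = Hole) = b \<and> site_count \<omega> I Neutral + of_bool (s = Neutral) = c" for s \<omega>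
  have sum: "a + b + c = Suc (card I)" using insert by simp
  have "prob {\<omega>. R (st \<omega> x) \<omega>} = rb * prob {\<omega>. R Ball \<omega>} + rh * prob {\<omega>. R Hole \<omega>} + rn * prob {\<omega>. R Neutral \<omega>}"
  proof (rule prob_site_split[where I = I])
    show "Measurable.pred N (R s)" for s
      unfolding R_def using insert.hyps(1) by measurable
    show "depends_on (R s) I" for s
      unfolding depends_on_def
    proof (intro allI impI)
      fix \<omega> \<omega>' :: "int \<Rightarrow> site"
      assume "\<forall>x\<in>I. \<omega> x = \<omega>' x"
      then have "{x \<in> I. st \<omega> x = s'} = {x \<in> I. st \<omega>' x = s'}" for s' by (auto simp: st_def)
      then show "R s \<omega> = R s \<omega>'" by (simp add: R_def site_count_def)
    qed
  qed (fact insert.hyps)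
  moreover have "rb * prob {\<omega>. R Ball \<omega>} = (if a = 0 then 0 else rb * trinomial rb rh rn (a - 1) b c)"
  proof (cases a)
    case (Suc a')
    then have "{\<omega>. R Ball \<omega>} = {\<omega>. ?E a' b c \<omega>}" by (auto simp: R_def)
    then show ?thesis using Suc sum insert.IH[of a' b c] by simp
  qed (simp add: R_def)
  moreover have "rh * prob {\<omega>. R Hole \<omega>} = (if b = 0 then 0 else rh * trinomial rb rh rn a (b - 1) c)"
  proof (cases b)
    case (Suc b')
    then have "{\<omega>. R Hole \<omega>} = {\<omega>. ?E a b' c \<omega>}" by (auto simp: R_def)
    then show ?thesis using Suc sum insert.IH[of a b' c] by simp
  qed (simp add: R_def)
  moreover have "rn * prob {\<omega>. R Neutral \<omega>} = (if c = 0 then 0 else rn * trinomial rb rh rn a b (c - 1))"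
  proof (cases c)
    case (Suc c')
    then have "{\<omega>. R Neutral \<omega>} = {\<omega>. ?E a b c' \<omega>}" by (auto simp: R_def)
    then show ?thesis using Suc sum insert.IH[of a b c'] by simp
  qed (simp add: R_def)
  ultimately have "prob {\<omega>. R (st \<omega> x) \<omega>} = trinomial rb rh rn a b c"
    by (simp only: trinomial_rec[OF sum, of rb rh rn])
  moreover have "{\<omega>. R (st \<omega> x) \<omega>} = {\<omega>. site_count \<omega> (insert x I) Ball = a \<and>
      site_count \<omega> (insert x I) Hole = b \<and> site_count \<omega> (insert x I) Neutral = c}"
    using insert.hyps by (auto simp: R_def site_count_insert)
  ultimately show ?case by simp
qed

text \<open>Among \<open>l + 1\<close> sites with surplus 1, the number \<open>b\<close> of balls
  determines the rest: \<open>b + 1\<close> holes and \<open>l - 2 * b\<close> neutral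
  sites.\<close>

lemma law_1_eq: "law (Suc l) 1 = (\<Sum>b\<in>{b. 2 * b \<le> l}. trinomial rb rh rn b (b + 1) (l - 2 * b))"
proof -
  let ?I = "{0..<int (Suc l)}"
  let ?E = "\<lambda>b \<omega>. site_count \<omega> ?I Ball = b \<and> site_count \<omega> ?I Hole = b + 1 \<and> site_count \<omega> ?I Neutral = l - 2 * b"
  have fin: "finite {b. 2 * b \<le> l}" by (rule finite_subset[of _ "{..l}"]) auto
  have card: "site_count \<omega> ?I Ball + site_count \<omega> ?I Hole + site_count \<omega> ?I Neutral = Suc l" for \<omega>
    by (simp add: site_count_total)
  have "{\<omega>. surplus \<omega> ?I = 1} = (\<Union>b\<in>{b. 2 * b \<le> l}. {\<omega>. ?E b \<omega>})"
  proof (intro set_eqI)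
    fix \<omega>
    have s: "surplus \<omega> ?I = 1 \<longleftrightarrow> site_count \<omega> ?I Hole = site_count \<omega> ?I Ball + 1"
      by (auto simp: surplus_eq_card site_count_def)
    show "\<omega> \<in> {\<omega>. surplus \<omega> ?I = 1} \<longleftrightarrow> \<omega> \<in> (\<Union>b\<in>{b. 2 * b \<le> l}. {\<omega>. ?E b \<omega>})"
      unfolding mem_Collect_eq UN_iff s using card[of \<omega>] by auto
  qed
  moreover have "card ?I = Suc l" by simp
  ultimately have "law (Suc l) 1 = prob (\<Union>b\<in>{b. 2 * b \<le> l}. {\<omega>. ?E b \<omega>})"
    using prob_surplus[of ?I 1] by (simp only: finite_atLeastLessThan_int)
  also have "\<dots> = (\<Sum>b\<in>{b. 2 * b \<le> l}. prob {\<omega>. ?E b \<omega>})"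
  proof (rule finite_measure_finite_Union[OF fin])
    have "{\<omega>. ?E b \<omega>} \<in> events" for b by (rule pred_sets_N) measurable
    then show "(\<lambda>b. {\<omega>. ?E b \<omega>}) ` {b. 2 * b \<le> l} \<subseteq> events" by blast
  qed (auto simp: disjoint_family_on_def)
  also have "\<dots> = (\<Sum>b\<in>{b. 2 * b \<le> l}. trinomial rb rh rn b (b + 1) (l - 2 * b))"
    by (intro sum.cong refl prob_count) auto
  finally show ?thesis .
qed

subsection \<open>Existence of barriers\<close>

lemma pred_hole [measurable]: "Measurable.pred N (\<lambda>\<omega>. st \<omega> x = s)"
  by measurable

lemma pred_barrier [measurable]: "Measurable.pred N (\<lambda>\<omega>. barrier \<omega> c)"
  unfolding barrier_def
  by (intro pred_intros_logic pred_intros_countable pred_hole pred_surplus) auto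

lemma pred_barrier_upto [measurable]: "Measurable.pred N (\<lambda>\<omega>. barrier_upto J \<omega> c)"
  unfolding barrier_upto_def
  by (intro pred_intros_logic pred_intros_countable_bounded pred_hole pred_surplus) auto

lemma prob_Ex_le:
  assumes "\<And>k::nat. Measurable.pred N (P k)" "\<And>k. prob {\<omega>. P k \<omega>} \<le> 2 * theta ^ (k + m)"
  shows "prob {\<omega>. \<exists>k. P k \<omega>} \<le> 2 * theta ^ m / (1 - theta)"
proof -
  have sums: "(\<lambda>k. 2 * theta ^ m * theta ^ k) sums (2 * theta ^ m * (1 / (1 - theta)))"
    using theta by (intro sums_mult geometric_sums) auto
  have le: "prob {\<omega>. P k \<omega>} \<le> 2 * theta ^ m * theta ^ k" for k
    using assms(2)[of k] by (simp add: power_add mult.commute mult.left_commute)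
  have summable: "summable (\<lambda>k. prob {\<omega>. P k \<omega>})"
    by (rule summable_comparison_test'[OF sums_summable[OF sums]]) (use le in auto)
  have "{\<omega>. \<exists>k. P k \<omega>} = (\<Union>k. {\<omega>. P k \<omega>})" by auto
  also have "prob \<dots> \<le> (\<Sum>k. prob {\<omega>. P k \<omega>})"
    using assms(1) by (intro finite_measure_subadditive_countably summable) (auto intro: pred_sets_N)
  also have "\<dots> \<le> (\<Sum>k. 2 * theta ^ m * theta ^ k)"
    by (rule suminf_le[OF le summable sums_summable[OF sums]])
  also have "\<dots> = 2 * theta ^ m / (1 - theta)"
    using sums by (simp add: sums_iff)
  finally show ?thesis .
qed

lemma prob_surplus_or_le:
  assumes "finite I" "finite I'" "card I = n" "card I' = n"
  shows "prob {\<omega>. surplus \<omega> I \<le> 0 \<or> surplus \<omega> I' \<le> 0} \<le> 2 * theta ^ n"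
proof -
  have "{\<omega>. surplus \<omega> I \<le> 0 \<or> surplus \<omega> I' \<le> 0} = {\<omega>. surplus \<omega> I \<le> 0} \<union> {\<omega>. surplus \<omega> I' \<le> 0}" by auto
  also have "prob \<dots> \<le> prob {\<omega>. surplus \<omega> I \<le> 0} + prob {\<omega>. surplus \<omega> I' \<le> 0}"
    using assms by (intro measure_Un_le pred_sets_N pred_surplus) auto
  also have "\<dots> \<le> theta ^ n + theta ^ n"
    using prob_surplus_le[of I 0] prob_surplus_le[of I' 0] assms by simp
  finally show ?thesis by simp
qed

text \<open>If the condition fails only beyond the truncation level, one side has a nonpositive
  surplus at some distance at least \<open>J\<close>. The tail bound summed over all these distances
  is a geometric series.\<close>

lemma prob_barrier_upto_not_barrier:
  "prob {\<omega>. barrier_upto J \<omega> c \<and> \<not> barrier \<omega> c} \<le> 2 * theta ^ J / (1 - theta)"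
proof -
  let ?P = "\<lambda>k \<omega>. surplus \<omega> {c - int (k + J)..c - 1} \<le> 0 \<or> surplus \<omega> {c + 1..c + int (k + J)} \<le> 0"
  have pred: "Measurable.pred N (?P k)" for k
    by (intro pred_intros_logic pred_surplus) auto
  have "{\<omega>. barrier_upto J \<omega> c \<and> \<not> barrier \<omega> c} \<subseteq> {\<omega>. \<exists>k. ?P k \<omega>}"
  proof
    fix \<omega> assume "\<omega> \<in> {\<omega>. barrier_upto J \<omega> c \<and> \<not> barrier \<omega> c}"
    then have b: "barrier_upto J \<omega> c" "\<not> barrier \<omega> c" by auto
    then obtain k where k: "\<not> (0 \<le> surplus \<omega> {c - int k..c - 1} \<and> 0 \<le> surplus \<omega> {c + 1..c + int k})"
      unfolding barrier_def barrier_upto_def by blast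
    then have "\<not> k \<le> J" using b(1) unfolding barrier_upto_def by blast
    then have "?P (k - J) \<omega>" using k by auto
    then show "\<omega> \<in> {\<omega>. \<exists>k. ?P k \<omega>}" by blast
  qed
  then have "prob {\<omega>. barrier_upto J \<omega> c \<and> \<not> barrier \<omega> c} \<le> prob {\<omega>. \<exists>k. ?P k \<omega>}"
    by (rule finite_measure_mono) (intro pred_sets_N pred_intros_countable pred)
  also have "\<dots> \<le> 2 * theta ^ J / (1 - theta)"
    by (rule prob_Ex_le[OF pred]) (intro prob_surplus_or_le; simp)
  finally show ?thesis .
qed

text \<open>A run of \<open>2K + 1\<close> holes around \<open>c\<close> compensates deficits of up to \<open>K\<close> beyond it.\<close>
lemma prob_barrier_ge: "\<exists>\<delta>>0. \<delta> \<le> 1 \<and> (\<forall>c. \<delta> \<le> prob {\<omega>. barrier \<omega> c})"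
proof -
  have "(\<lambda>K. 2 * theta ^ K / (1 - theta)) \<longlonglongrightarrow> 2 * 0 / (1 - theta)"
    using theta by (intro tendsto_intros LIMSEQ_realpow_zero) auto
  then have "\<forall>\<^sub>F K in sequentially. 2 * theta ^ K / (1 - theta) < 1"
    by (rule order_tendstoD(2)) simp
  \<comment> \<open>This large, the union bound for a nonpositive surplus at some distance at least
    \<open>K\<close> is nontrivial, which makes \<open>\<delta>\<close> positive.\<close>
  then obtain K where K: "2 * theta ^ K / (1 - theta) < 1"
    using eventually_happens'[OF sequentially_bot] by blast
  define \<delta> where "\<delta> = rh ^ (2 * K + 1) * (1 - 2 * theta ^ K / (1 - theta))"
  have "\<delta> \<le> prob {\<omega>. barrier \<omega> c}" for c
  proof -
    let ?J = "{c - int K..c + int K}"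
    let ?A = "\<lambda>\<omega>. \<forall>x\<in>?J. st \<omega> x = Hole"
    let ?L = "\<lambda>k. {c - int K - int (k + K)..c - int K - 1}" and ?R = "\<lambda>k. {c + int K + 1..c + int K + int (k + K)}"
    let ?D = "\<lambda>k \<omega>. surplus \<omega> (?L k) \<le> 0 \<or> surplus \<omega> (?R k) \<le> 0"
    let ?B = "\<lambda>\<omega>. \<forall>k. \<not> ?D k \<omega>"
    have predD: "Measurable.pred N (?D k)" for k by (intro pred_intros_logic pred_surplus) auto
    have predA: "Measurable.pred N ?A" by (intro pred_intros_countable_bounded pred_hole)
    have predB: "Measurable.pred N ?B" by (intro pred_intros_logic pred_intros_countable predD)
    have "prob {\<omega>. ?A \<omega> \<and> ?B \<omega>} = prob {\<omega>. ?A \<omega>} * prob {\<omega>. ?B \<omega>}"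
    proof (rule prob_conj_disjoint[OF predA _ predB, where I = ?J and J = "- ?J"])
      show "depends_on ?A ?J" by (auto simp: depends_on_def st_def)
      show "depends_on ?B (- ?J)"
        unfolding depends_on_def
      proof (intro allI impI)
        fix \<omega> \<omega>' :: "int \<Rightarrow> site"
        assume eq: "\<forall>x\<in>- ?J. \<omega> x = \<omega>' x"
        have "surplus \<omega> I = surplus \<omega>' I" if "I \<inter> ?J = {}" for I
        proof -
          have "\<omega> x = \<omega>' x" if "x \<in> I" for x
            using eq that \<open>I \<inter> ?J = {}\<close> by blast
          then show ?thesis unfolding surplus_def by (intro sum.cong) (auto simp: st_def)
        qed
        then have "surplus \<omega> (?L k) = surplus \<omega>' (?L k)" "surplus \<omega> (?R k) = surplus \<omega>' (?R k)" for k
          by auto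
        then show "?B \<omega> = ?B \<omega>'" by simp
      qed
    qed simp
    also have "prob {\<omega>. ?A \<omega>} = rh ^ (2 * K + 1)"
    proof -
      have A: "{s. fst s = Hole} \<in> sets (site_measure p rb rh)"
      proof -
        have "fst -` {Hole} \<inter> space (site_measure p rb rh) \<in> sets (site_measure p rb rh)"
          unfolding site_measure_def by (rule measurable_sets[OF measurable_fst]) simp
        then show ?thesis by (simp add: space_S vimage_def)
      qed
      have "measure (site_measure p rb rh) {s. fst s = Hole} = rh"
        using prob_coordinate[OF A, of c] prob_st[of c Hole] by (simp add: st_def pmf_state)
      moreover have "card ?J = 2 * K + 1" by simp
      ultimately show ?thesis
        using prob_all_coordinates[OF A, of ?J] by (simp add: st_def)
    qed
    also have "prob {\<omega>. ?B \<omega>} = 1 - prob {\<omega>. \<exists>k. ?D k \<omega>}"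
    proof -
      have "{\<omega>. ?B \<omega>} = {\<omega>. \<not> (\<exists>k. ?D k \<omega>)}" by blast
      moreover have "Measurable.pred N (\<lambda>\<omega>. \<exists>k. ?D k \<omega>)" by (intro pred_intros_countable predD)
      ultimately show ?thesis by (simp only: prob_not)
    qed
    finally have AB: "prob {\<omega>. ?A \<omega> \<and> ?B \<omega>} = rh ^ (2 * K + 1) * (1 - prob {\<omega>. \<exists>k. ?D k \<omega>})" .
    have "prob {\<omega>. \<exists>k. ?D k \<omega>} \<le> 2 * theta ^ K / (1 - theta)"
      by (rule prob_Ex_le[OF predD]) (intro prob_surplus_or_le; simp)
    then have "\<delta> \<le> prob {\<omega>. ?A \<omega> \<and> ?B \<omega>}"
      unfolding AB \<delta>_def using rb_pos rb_less_rh by (intro mult_left_mono) auto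
    also have "\<dots> \<le> prob {\<omega>. barrier \<omega> c}"
    proof (rule finite_measure_mono)
      show "{\<omega>. barrier \<omega> c} \<in> events" by (rule pred_sets_N[OF pred_barrier])
      show "{\<omega>. ?A \<omega> \<and> ?B \<omega>} \<subseteq> {\<omega>. barrier \<omega> c}"
      proof
        fix \<omega> assume "\<omega> \<in> {\<omega>. ?A \<omega> \<and> ?B \<omega>}"
        then have A: "?A \<omega>" and B: "\<And>k. \<not> ?D k \<omega>" by auto
        have holes: "surplus \<omega> I = int (card I)" if "I \<subseteq> ?J" for I
        proof -
          have "surplus \<omega> I = (\<Sum>x\<in>I. 1)"
            unfolding surplus_def using that A by (intro sum.cong) auto
          then show ?thesis by simp
        qed
        have ge: "- int (card I) \<le> surplus \<omega> I" for I
        proof -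
          have "(\<Sum>x\<in>I. - 1) \<le> surplus \<omega> I"
            unfolding surplus_def by (intro sum_mono) (simp add: weight_def)
          then show ?thesis by simp
        qed
        have un: "surplus \<omega> (I \<union> I') = surplus \<omega> I + surplus \<omega> I'" if "finite I" "finite I'" "I \<inter> I' = {}" for I I'
          unfolding surplus_def using that by (rule sum.union_disjoint)
        have "0 \<le> surplus \<omega> {c - int k..c - 1} \<and> 0 \<le> surplus \<omega> {c + 1..c + int k}" for k
        proof (cases "k \<le> K")
          case True
          then have "{c - int k..c - 1} \<subseteq> ?J" "{c + 1..c + int k} \<subseteq> ?J" by auto
          then show ?thesis using holes by simp
        next
          case False
          define d where "d = k - K"
          have split: "{c - int k..c - 1} = {c - int K - int d..c - int K - 1} \<union> {c - int K..c - 1}"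
            "{c + 1..c + int k} = {c + int K + 1..c + int K + int d} \<union> {c + 1..c + int K}"
            using False by (auto simp: d_def)
          \<comment> \<open>Within distance \<open>K\<close> of the block of holes each site costs
            at most 1; from distance \<open>K\<close> on, the event \<open>?B\<close> makes the
            surplus even positive.\<close>
          have "- int K \<le> surplus \<omega> {c - int K - int d..c - int K - 1} \<and>
              - int K \<le> surplus \<omega> {c + int K + 1..c + int K + int d}"
          proof (cases "d \<le> K")
            case True
            then show ?thesis
              using ge[of "{c - int K - int d..c - int K - 1}"] ge[of "{c + int K + 1..c + int K + int d}"]
              by simp
          next
            case False
            then have "int (d - K + K) = int d" by simp
            then show ?thesis using B[of "d - K"] by auto
          qed
          moreover have "surplus \<omega> {c - int K..c - 1} = int K" "surplus \<omega> {c + 1..c + int K} = int K"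
            by (subst holes; auto)+
          ultimately show ?thesis
            unfolding split by (subst un, simp, simp, force)+ simp
        qed
        moreover have "st \<omega> c = Hole" using A by simp
        ultimately show "\<omega> \<in> {\<omega>. barrier \<omega> c}" by (simp add: barrier_def)
      qed
    qed
    finally show ?thesis .
  qed
  moreover have "0 < \<delta>" unfolding \<delta>_def using K rb_pos rb_less_rh by (intro mult_pos_pos) auto
  moreover have "\<delta> \<le> 1" using calculation(1)[of 0] prob_le_1 by (rule order_trans)
  ultimately show ?thesis by blast
qed

text \<open>Being a barrier involves all sites, so barriers at different sites are dependent.
  Instead \<open>n\<close> sites at spacing \<open>2 * J + 1\<close> are tested for truncated
  barriers, which are independent, and the truncation costs at most \<open>n\<close> times an error
  that decays geometrically in \<open>J\<close>. Letting \<open>J\<close> grow first and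
  \<open>n\<close> afterwards leaves probability 0 for the absence of barriers. The sign \<sigma>
  treats both directions at once.\<close>

lemma AE_exists_barrier:
  fixes a \<sigma> :: int
  assumes "\<sigma> = 1 \<or> \<sigma> = - 1"
  shows "AE \<omega> in N. \<exists>i::nat. barrier \<omega> (a + \<sigma> * int i)"
proof -
  obtain \<delta> where \<delta>: "0 < \<delta>" "\<delta> \<le> 1" "\<And>c. \<delta> \<le> prob {\<omega>. barrier \<omega> c}"
    using prob_barrier_ge by blast
  define Bad where "Bad = {\<omega>. \<forall>i::nat. \<not> barrier \<omega> (a + \<sigma> * int i)}"
  have Bad: "Bad \<in> events"
    unfolding Bad_def by (rule pred_sets_N) measurable
  have bound: "prob Bad \<le> (1 - \<delta>) ^ n + real n * (2 * theta ^ J / (1 - theta))" for n J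
  proof -
    define c where "c i = a + \<sigma> * int (i * (2 * J + 1))" for i
    let ?T = "{\<omega>. \<forall>i<n. \<not> barrier_upto J \<omega> (c i)}"
    let ?E = "\<lambda>i. {\<omega>. barrier_upto J \<omega> (c i) \<and> \<not> barrier \<omega> (c i)}"
    have T: "?T \<in> events" by (rule pred_sets_N) measurable
    have E: "?E i \<in> events" for i by (rule pred_sets_N) measurable
    have "Bad \<subseteq> ?T \<union> (\<Union>i\<in>{..<n}. ?E i)"
      unfolding Bad_def c_def by blast
    then have "prob Bad \<le> prob (?T \<union> (\<Union>i\<in>{..<n}. ?E i))"
      using T E by (intro finite_measure_mono) auto
    also have "\<dots> \<le> prob ?T + prob (\<Union>i\<in>{..<n}. ?E i)"
      using T E by (intro measure_Un_le) auto
    also have "prob ?T \<le> (1 - \<delta>) ^ n"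
    proof (rule prob_none_le[where I = "\<lambda>i. {c i - int J..c i + int J}"])
      show "{c i - int J..c i + int J} \<inter> {c j - int J..c j + int J} = {}" if "i < j" for i j
      proof -
        have "Suc i * (2 * J + 1) \<le> j * (2 * J + 1)" using that by (intro mult_le_mono1) simp
        then have "int (Suc i * (2 * J + 1)) \<le> int (j * (2 * J + 1))" by (simp only: of_nat_le_iff)
        moreover have "int (Suc i * (2 * J + 1)) = int (i * (2 * J + 1)) + 2 * int J + 1" by simp
        ultimately have "int (i * (2 * J + 1)) + 2 * int J + 1 \<le> int (j * (2 * J + 1))" by linarith
        then show ?thesis using assms unfolding c_def by auto
      qed
      show "\<delta> \<le> prob {\<omega>. barrier_upto J \<omega> (c i)}" for i
        using \<delta>(3)[of "c i"] by (rule order_trans)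
          (intro finite_measure_mono pred_sets_N pred_barrier_upto, auto intro: barrier_imp_upto)
    qed (use \<delta> depends_on_barrier_upto in auto)
    also have "prob (\<Union>i\<in>{..<n}. ?E i) \<le> (\<Sum>i\<in>{..<n}. prob (?E i))"
      using E by (intro finite_measure_subadditive_finite) auto
    also have "\<dots> \<le> (\<Sum>i\<in>{..<n}. 2 * theta ^ J / (1 - theta))"
      by (intro sum_mono prob_barrier_upto_not_barrier)
    finally show ?thesis by simp
  qed
  have "prob Bad \<le> (1 - \<delta>) ^ n" for n
  proof (rule LIMSEQ_le_const)
    show "(\<lambda>J. (1 - \<delta>) ^ n + real n * (2 * theta ^ J / (1 - theta))) \<longlonglongrightarrow> (1 - \<delta>) ^ n"
    proof -
      have "(\<lambda>J. (1 - \<delta>) ^ n + real n * (2 * theta ^ J / (1 - theta))) \<longlonglongrightarrow> (1 - \<delta>) ^ n + real n * (2 * 0 / (1 - theta))"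
        using theta by (intro tendsto_intros LIMSEQ_realpow_zero) auto
      then show ?thesis by simp
    qed
  qed (use bound in auto)
  moreover have "(\<lambda>n. (1 - \<delta>) ^ n) \<longlonglongrightarrow> 0"
    using \<delta> by (intro LIMSEQ_realpow_zero) auto
  ultimately have "prob Bad \<le> 0"
    by (intro LIMSEQ_le_const[of "\<lambda>n. (1 - \<delta>) ^ n"]) auto
  then have "prob Bad = 0" by (simp add: measure_le_0_iff)
  then have "AE \<omega> in N. \<omega> \<notin> Bad" using Bad by (simp add: prob_eq_0)
  then show ?thesis by (simp add: Bad_def)
qed

lemma AE_barriers: "AE \<omega> in N. \<forall>m. (\<exists>c\<le>m. barrier \<omega> c) \<and> (\<exists>c\<ge>m. barrier \<omega> c)"
proof -
  have "AE \<omega> in N. \<forall>m. (\<exists>i::nat. barrier \<omega> (m + (- 1) * int i)) \<and> (\<exists>i::nat. barrier \<omega> (m + 1 * int i))"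
    unfolding AE_all_countable by (intro allI AE_conjI AE_exists_barrier) auto
  then show ?thesis
  proof (rule AE_mp, intro AE_I2 impI allI conjI)
    fix \<omega> m
    assume *: "\<forall>m. (\<exists>i::nat. barrier \<omega> (m + (- 1) * int i)) \<and> (\<exists>i::nat. barrier \<omega> (m + 1 * int i))"
    then obtain i :: nat where "barrier \<omega> (m + (- 1) * int i)" by blast
    then show "\<exists>c\<le>m. barrier \<omega> c" by (intro exI[of _ "m + (- 1) * int i"]) simp
    from * obtain i :: nat where "barrier \<omega> (m + 1 * int i)" by blast
    then show "\<exists>c\<ge>m. barrier \<omega> c" by (intro exI[of _ "m + 1 * int i"]) simp
  qed
qed

subsection \<open>The law of the gap\<close>

definition left_prob :: "nat \<Rightarrow> real" where
  "left_prob n = prob {\<omega>. 0 \<in> final id \<omega> (- int n) (- 1) {0}}"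

definition right_prob :: "nat \<Rightarrow> real" where
  "right_prob n = prob {\<omega>. 0 \<in> final id \<omega> 1 (int n) {0}}"

definition block_prob :: "nat \<Rightarrow> real" where
  "block_prob l = prob {\<omega>. final id \<omega> 1 (int l) {0, int l + 1} = {0, int l + 1}}"

lemma prob_final_shift:
  assumes "finite F"
  shows "prob {\<omega>. P ((\<lambda>x. x - s) ` final id \<omega> (i + s) (j + s) ((\<lambda>x. x + s) ` F))} = prob {\<omega>. P (final id \<omega> i j F)}"
  using prob_shift[OF pred_final[OF assms, of P id i j], of s] by (simp only: final_shift)

lemma prob_left: "prob {\<omega>. a \<in> final id \<omega> (a - int n) (a - 1) {a}} = left_prob n"
proof -
  have "a \<in> S \<longleftrightarrow> 0 \<in> (\<lambda>x. x - a) ` S" for S by auto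
  then show ?thesis
    using prob_final_shift[of "{0}" "\<lambda>S. 0 \<in> S" a "- int n" "- 1"] by (simp add: left_prob_def)
qed

lemma prob_right: "prob {\<omega>. b \<in> final id \<omega> (b + 1) (b + int n) {b}} = right_prob n"
proof -
  have "b \<in> S \<longleftrightarrow> 0 \<in> (\<lambda>x. x - b) ` S" for S by auto
  then show ?thesis
    using prob_final_shift[of "{0}" "\<lambda>S. 0 \<in> S" b 1 "int n"] by (simp add: right_prob_def add.commute)
qed

lemma prob_block:
  "prob {\<omega>. final id \<omega> (a + 1) (a + int l) {a, a + int l + 1} = {a, a + int l + 1}} = block_prob l"
proof -
  have inj: "inj (\<lambda>x. x - a)" by (simp add: inj_def)
  have img: "(\<lambda>x. x - a) ` {a, a + int l + 1} = {0, int l + 1}" by simp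
  have "S = {a, a + int l + 1} \<longleftrightarrow> (\<lambda>x. x - a) ` S = {0, int l + 1}" for S
    unfolding img[symmetric] by (rule inj_image_eq_iff[OF inj, symmetric])
  then show ?thesis
    using prob_final_shift[of "{0, int l + 1}" "\<lambda>S. S = {0, int l + 1}" a 1 "int l"]
    by (simp add: block_prob_def add.commute add.left_commute)
qed

text \<open>The five conditions of \<open>consecutive_final_iff\<close> are independent and are
  split off one at a time. The window extends by \<open>n\<close> beyond each end of the gap, so
  that the outer factors depend on \<open>n\<close> but not on the gap.\<close>

lemma prob_consecutive_window:
  fixes a b :: int
  assumes "b = a + int l + 1"
  shows "prob {\<omega>. consecutive (final id \<omega> (a - int n) (b + int n) {}) a b} =
    rh * rh * left_prob n * right_prob n * block_prob l"
proof -
  let ?A = "\<lambda>\<omega>. st \<omega> a = Hole" and ?B = "\<lambda>\<omega>. st \<omega> b = Hole"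
    and ?L = "\<lambda>\<omega>. a \<in> final id \<omega> (a - int n) (a - 1) {a}"
    and ?I = "\<lambda>\<omega>. final id \<omega> (a + 1) (b - 1) {a, b} = {a, b}"
    and ?R = "\<lambda>\<omega>. b \<in> final id \<omega> (b + 1) (b + int n) {b}"
  have p: "Measurable.pred N ?L" "Measurable.pred N ?I" "Measurable.pred N ?R"
    by (rule pred_final; simp)+
  have d: "depends_on ?A {a}" "depends_on ?B {b}" by (rule depends_on_st)+
  have d': "depends_on ?L {a - int n..a - 1}" "depends_on ?I {a + 1..b - 1}" "depends_on ?R {b + 1..b + int n}"
    by (rule depends_on_final)+
  have IR: "prob {\<omega>. ?I \<omega> \<and> ?R \<omega>} = prob {\<omega>. ?I \<omega>} * prob {\<omega>. ?R \<omega>}"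
    by (rule prob_conj_disjoint[OF p(2) d'(2) p(3) d'(3)]) auto
  have LIR: "prob {\<omega>. ?L \<omega> \<and> ?I \<omega> \<and> ?R \<omega>} = prob {\<omega>. ?L \<omega>} * prob {\<omega>. ?I \<omega> \<and> ?R \<omega>}"
    by (rule prob_conj_disjoint[OF p(1) d'(1) _ depends_on_conj[OF d'(2,3)]])
      (use p assms in auto)
  have BLIR: "prob {\<omega>. ?B \<omega> \<and> ?L \<omega> \<and> ?I \<omega> \<and> ?R \<omega>} = prob {\<omega>. ?B \<omega>} * prob {\<omega>. ?L \<omega> \<and> ?I \<omega> \<and> ?R \<omega>}"
    by (rule prob_conj_disjoint[OF pred_hole d(2) _ depends_on_conj[OF d'(1) depends_on_conj[OF d'(2,3)]]])
      (use p assms in auto)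
  have ABLIR: "prob {\<omega>. ?A \<omega> \<and> ?B \<omega> \<and> ?L \<omega> \<and> ?I \<omega> \<and> ?R \<omega>} = prob {\<omega>. ?A \<omega>} * prob {\<omega>. ?B \<omega> \<and> ?L \<omega> \<and> ?I \<omega> \<and> ?R \<omega>}"
    by (rule prob_conj_disjoint[OF pred_hole d(1) _ depends_on_conj[OF d(2) depends_on_conj[OF d'(1) depends_on_conj[OF d'(2,3)]]]])
      (use p assms in \<open>auto intro: pred_hole\<close>)
  have "{\<omega>. consecutive (final id \<omega> (a - int n) (b + int n) {}) a b} = {\<omega>. ?A \<omega> \<and> ?B \<omega> \<and> ?L \<omega> \<and> ?I \<omega> \<and> ?R \<omega>}"
    using assms by (intro Collect_cong consecutive_final_iff) auto
  moreover have "prob {\<omega>. ?I \<omega>} = block_prob l"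
    using prob_block[of a l] assms by simp
  ultimately show ?thesis
    by (simp add: ABLIR BLIR LIR IR prob_left prob_right prob_st pmf_state)
qed

section \<open>Passage to infinite volume\<close>

lemma pred_H1 [measurable]: "Measurable.pred N (\<lambda>\<omega>. y \<in> H1 \<omega>)"
proof -
  have "Measurable.pred N (\<lambda>\<omega>. y \<in> free_fin n \<omega>)" for n
    unfolding free_fin_eq by (rule pred_final) simp
  then show ?thesis
    unfolding H1_def mem_Collect_eq eventually_sequentially
    by (intro pred_intros_countable pred_intros_logic) auto
qed

lemma pred_consecutive_H1 [measurable]: "Measurable.pred N (\<lambda>\<omega>. consecutive (H1 \<omega>) a b)"
  unfolding consecutive_def by measurable

lemma consecutive_window_tendsto:
  fixes a b :: int
  assumes "a < b"
  shows "(\<lambda>n. prob {\<omega>. consecutive (final id \<omega> (a - int n) (b + int n) {}) a b}) \<longlonglongrightarrow>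
    prob {\<omega>. consecutive (H1 \<omega>) a b}"
proof (rule prob_tendsto_of_AE_eventually)
  show "{\<omega>. consecutive (final id \<omega> (a - int n) (b + int n) {}) a b} \<in> events" for n
    by (rule pred_sets_N, rule pred_final) simp
  show "{\<omega>. consecutive (H1 \<omega>) a b} \<in> events" by (rule pred_sets_N) measurable
  show "AE \<omega> in N. \<forall>\<^sub>F n in sequentially. (\<omega> \<in> {\<omega>. consecutive (final id \<omega> (a - int n) (b + int n) {}) a b} \<longleftrightarrow>
      \<omega> \<in> {\<omega>. consecutive (H1 \<omega>) a b})"
    using AE_barriers
  proof (rule AE_mp, intro AE_I2 impI)
    fix \<omega> assume B: "\<forall>m. (\<exists>c\<le>m. barrier \<omega> c) \<and> (\<exists>c\<ge>m. barrier \<omega> c)"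
    \<comment> \<open>The barriers are taken strictly outside \<open>[a, b]\<close>, so that the
      ends \<open>a\<close> and \<open>b\<close> themselves lie strictly between them.\<close>
    obtain c where c: "c \<le> a - 1" "barrier \<omega> c" using B by blast
    obtain d where d: "b + 1 \<le> d" "barrier \<omega> d" using B by blast
    have "consecutive (final id \<omega> (a - int n) (b + int n) {}) a b \<longleftrightarrow> consecutive (H1 \<omega>) a b"
      if "nat (max (a - c) (d - b)) \<le> n" for n
    proof -
      have "y \<in> final id \<omega> (a - int n) (b + int n) {} \<longleftrightarrow> y \<in> H1 \<omega>" if "a \<le> y" "y \<le> b" for y
      proof -
        have "c < y" "y < d" "a - int n \<le> c" "d \<le> b + int n"
          using c(1) d(1) that \<open>nat (max (a - c) (d - b)) \<le> n\<close> by auto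
        then show ?thesis
          using H1_between_barriers[OF c(2) d(2), of y] final_between_barriers[OF c(2) d(2), of "a - int n" y "b + int n"]
          by simp
      qed
      then show ?thesis using assms unfolding consecutive_def by auto
    qed
    then show "\<forall>\<^sub>F n in sequentially. (\<omega> \<in> {\<omega>. consecutive (final id \<omega> (a - int n) (b + int n) {}) a b} \<longleftrightarrow>
      \<omega> \<in> {\<omega>. consecutive (H1 \<omega>) a b})"
      unfolding eventually_sequentially mem_Collect_eq by blast
  qed
qed

text \<open>Here \<open>p\<close> disappears: \<open>block_prob\<close> is defined by the dynamics,
  while \<open>law\<close> involves the initial states only. The factor \<open>Suc l\<close> counts
  the sites at which the single free hole of the circle may lie.\<close>

lemma prob_circle_hole:
  fixes l :: nat
  defines "M \<equiv> int l + 1"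
  shows "rh * block_prob l * real (Suc l) = law (Suc l) 1"
proof -
  let ?C = "\<lambda>\<omega>. final (\<lambda>y. y mod M) \<omega> 0 (M - 1) {}"
  have M: "0 < M" by (simp add: M_def)
  have C: "{\<omega>. ?C \<omega> = {x}} \<in> events" for x by (rule pred_sets_N, rule pred_final) simp
  have zero: "prob {\<omega>. ?C \<omega> = {0}} = rh * block_prob l"
  proof -
    have "prob {\<omega>. st \<omega> 0 = Hole \<and> final id \<omega> 1 (M - 1) {0, M} = {0, M}} =
        prob {\<omega>. st \<omega> 0 = Hole} * prob {\<omega>. final id \<omega> 1 (M - 1) {0, M} = {0, M}}"
      by (rule prob_conj_disjoint[OF pred_hole depends_on_st _ depends_on_final]) (auto intro: pred_final)
    then show ?thesis
      by (simp add: circle_final_iff[OF M] prob_st pmf_state block_prob_def) (simp add: M_def)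
  qed
  have rot: "prob {\<omega>. ?C \<omega> = {x}} = prob {\<omega>. ?C \<omega> = {0}}" if "x \<in> {0..<M}" for x
  proof -
    let ?\<pi> = "rotation M x"
    have inj: "inj ?\<pi>" using rotation_bij(1)[OF M] by (rule bij_is_inj)
    have "prob {\<omega>. ?C (\<omega> \<circ> ?\<pi>) = {0}} = prob {\<omega>. ?C \<omega> = {0}}"
      by (rule prob_reindex[OF inj]) (rule pred_final, simp)
    \<comment> \<open>The two events agree only almost surely, since the rotation identity is
      available for distinct clocks.\<close>
    moreover have "prob {\<omega>. ?C \<omega> = {x}} = prob {\<omega>. ?C (\<omega> \<circ> ?\<pi>) = {0}}"
    proof (rule measure_eq_AE)
      show "AE \<omega> in N. \<omega> \<in> {\<omega>. ?C \<omega> = {x}} \<longleftrightarrow> \<omega> \<in> {\<omega>. ?C (\<omega> \<circ> ?\<pi>) = {0}}"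
        using AE_clock_inj
      proof (rule AE_mp, intro AE_I2 impI)
        fix \<omega> :: "int \<Rightarrow> site" assume "inj (clock \<omega>)"
        then have eq: "?C \<omega> = ?\<pi> ` ?C (\<omega> \<circ> ?\<pi>)"
          by (intro final_rotation[OF M]) (rule inj_on_subset, auto)
        have x: "{x} = ?\<pi> ` {0}" using that M by (simp add: rotation_def)
        have "?C \<omega> = {x} \<longleftrightarrow> ?C (\<omega> \<circ> ?\<pi>) = {0}"
          unfolding eq x by (rule inj_image_eq_iff[OF inj])
        then show "\<omega> \<in> {\<omega>. ?C \<omega> = {x}} \<longleftrightarrow> \<omega> \<in> {\<omega>. ?C (\<omega> \<circ> ?\<pi>) = {0}}" by simp
      qed
      have "(\<lambda>\<omega>. \<omega> \<circ> ?\<pi>) \<in> N \<rightarrow>\<^sub>M N"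
        unfolding comp_def by (intro measurable_abs_UNIV) auto
      from measurable_sets[OF this C[of 0]] show "{\<omega>. ?C (\<omega> \<circ> ?\<pi>) = {0}} \<in> events"
        by (simp add: vimage_def)
    qed (rule C)
    ultimately show ?thesis by simp
  qed
  have "law (Suc l) 1 = prob {\<omega>. surplus \<omega> {0..<M} = 1}"
  proof -
    have "card {0..<M} = Suc l" by (simp add: M_def)
    then show ?thesis using prob_surplus[of "{0..<M}" 1] by (simp only: finite_atLeastLessThan_int)
  qed
  also have "\<dots> = prob (\<Union>x\<in>{0..<M}. {\<omega>. ?C \<omega> = {x}})"
  proof (rule measure_eq_AE)
    have "AE \<omega> in N. (\<forall>x. clock \<omega> x \<le> 1) \<and> (\<forall>x. \<forall>y\<in>{0..<int (Suc l)}. \<exists>k. walk \<omega> x k mod int (Suc l) = y)"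
      using AE_clock_le AE_walk_covers[of "Suc l"] by simp
    then show "AE \<omega> in N. \<omega> \<in> {\<omega>. surplus \<omega> {0..<M} = 1} \<longleftrightarrow> \<omega> \<in> (\<Union>x\<in>{0..<M}. {\<omega>. ?C \<omega> = {x}})"
    proof (rule AE_mp, intro AE_I2 impI)
      fix \<omega> :: "int \<Rightarrow> site"
      assume *: "(\<forall>x. clock \<omega> x \<le> 1) \<and> (\<forall>x. \<forall>y\<in>{0..<int (Suc l)}. \<exists>k. walk \<omega> x k mod int (Suc l) = y)"
      have M': "int (Suc l) = M" by (simp add: M_def)
      have "(\<exists>x\<in>{0..<M}. ?C \<omega> = {x}) \<longleftrightarrow> surplus \<omega> {0..<M} = 1"
        by (rule circle_single_iff[OF M]) (use * in \<open>auto simp only: M'\<close>)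
      then show "\<omega> \<in> {\<omega>. surplus \<omega> {0..<M} = 1} \<longleftrightarrow> \<omega> \<in> (\<Union>x\<in>{0..<M}. {\<omega>. ?C \<omega> = {x}})"
        by auto
    qed
    show "{\<omega>. surplus \<omega> {0..<M} = 1} \<in> events" by (rule pred_sets_N, rule pred_surplus) simp
  qed (use C in auto)
  also have "\<dots> = (\<Sum>x\<in>{0..<M}. prob {\<omega>. ?C \<omega> = {x}})"
    by (rule finite_measure_finite_Union) (use C in \<open>auto simp: disjoint_family_on_def\<close>)
  also have "\<dots> = (\<Sum>x\<in>{0..<M}. rh * block_prob l)"
    by (intro sum.cong refl) (simp add: rot zero)
  also have "\<dots> = rh * block_prob l * real (Suc l)" by (simp add: M_def algebra_simps)
  finally show ?thesis ..
qed

text \<open>The outer factors do not depend on the gap, so the limit of their product can be read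
  off from the shortest gap, two adjacent holes, for which \<open>block_prob\<close> is 1.\<close>

lemma prob_consecutive_H1:
  "prob {\<omega>. consecutive (H1 \<omega>) a (a + int l + 1)} = prob {\<omega>. consecutive (H1 \<omega>) 0 1} * block_prob l"
proof -
  let ?x = "\<lambda>n. rh * rh * left_prob n * right_prob n"
  have lim: "(\<lambda>n. ?x n * block_prob l) \<longlonglongrightarrow> prob {\<omega>. consecutive (H1 \<omega>) a (a + int l + 1)}" for a l
    using consecutive_window_tendsto[of a "a + int l + 1"] by (simp add: prob_consecutive_window)
  have "block_prob 0 = 1"
  proof -
    have "final id \<omega> 1 0 {0, 1} = {0, 1}" for \<omega>
      by (simp add: final_def holes_in_def balls_in_def)
    then show ?thesis by (simp add: block_prob_def)
  qed
  then have "?x \<longlonglongrightarrow> prob {\<omega>. consecutive (H1 \<omega>) 0 1}" using lim[of 0 0] by simp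
  then have "(\<lambda>n. ?x n * block_prob l) \<longlonglongrightarrow> prob {\<omega>. consecutive (H1 \<omega>) 0 1} * block_prob l"
    by (rule tendsto_mult_right)
  with lim show ?thesis by (rule LIMSEQ_unique)
qed

text \<open>The \<open>l + 1\<close> positions of the gap are disjoint events of equal probability.
  Their number is exactly the factor with which \<open>block_prob\<close> enters
  \<open>prob_circle_hole\<close>.\<close>

lemma prob_gap0_eq:
  "prob {\<omega>. gap0_eq \<omega> (int l)} = prob {\<omega>. consecutive (H1 \<omega>) 0 1} / rh * law (Suc l) 1"
proof -
  let ?P = "\<lambda>a. {\<omega>. consecutive (H1 \<omega>) a (a + int l + 1)}"
  have "{\<omega>. gap0_eq \<omega> (int l)} = (\<Union>a\<in>{- int l..0}. ?P a)"
    unfolding gap0_eq_iff by blast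
  also have "prob \<dots> = (\<Sum>a\<in>{- int l..0}. prob (?P a))"
  proof (rule finite_measure_finite_Union)
    have "?P a \<in> events" for a by (rule pred_sets_N) measurable
    then show "?P ` {- int l..0} \<subseteq> events" by blast
    show "disjoint_family_on ?P {- int l..0}"
      unfolding disjoint_family_on_def
    proof (intro ballI impI)
      fix a a' assume "a \<in> {- int l..0}" "a' \<in> {- int l..0}" "a \<noteq> a'"
      then show "?P a \<inter> ?P a' = {}"
        using consecutive_unique(1)[of _ a "a + int l + 1" a' "a' + int l + 1"] by auto
    qed
  qed simp
  also have "\<dots> = real (Suc l) * (prob {\<omega>. consecutive (H1 \<omega>) 0 1} * block_prob l)"
    unfolding prob_consecutive_H1 by simp
  also have "\<dots> = prob {\<omega>. consecutive (H1 \<omega>) 0 1} * (block_prob l * real (Suc l))"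
    by (simp only: mult_ac)
  also have "block_prob l * real (Suc l) = law (Suc l) 1 / rh"
  proof -
    have "rh \<noteq> 0" using rb_pos rb_less_rh by simp
    then show ?thesis unfolding prob_circle_hole[of l, symmetric] by simp
  qed
  finally show ?thesis by (simp only: times_divide_eq_right times_divide_eq_left)
qed

text \<open>Normalisation: barriers are free holes and exist on both sides of 0, so almost surely
  there is a gap, and the probabilities of its lengths sum to 1. Comparison with
  \<open>law_sums\<close> gives the constant.\<close>

lemma prob_consecutive_H1_0_1: "prob {\<omega>. consecutive (H1 \<omega>) 0 1} / rh = rh - rb"
proof -
  let ?\<kappa> = "prob {\<omega>. consecutive (H1 \<omega>) 0 1} / rh" and ?A = "\<lambda>l::nat. {\<omega>. gap0_eq \<omega> (int l)}"
  have A: "?A l \<in> events" for l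
    unfolding gap0_eq_iff by (rule pred_sets_N) measurable
  have "(\<lambda>l. prob (?A l)) sums prob (\<Union>l. ?A l)"
  proof (rule finite_measure_UNION)
    show "range ?A \<subseteq> events" using A by blast
    have "l = l'" if g: "gap0_eq \<omega> (int l)" "gap0_eq \<omega> (int l')" for \<omega> l l'
    proof -
      obtain a where a: "a \<in> {- int l..0}" "consecutive (H1 \<omega>) a (a + int l + 1)"
        using g(1) unfolding gap0_eq_iff by blast
      obtain a' where a': "a' \<in> {- int l'..0}" "consecutive (H1 \<omega>) a' (a' + int l' + 1)"
        using g(2) unfolding gap0_eq_iff by blast
      show ?thesis using consecutive_unique[OF a(2) a'(2)] a(1) a'(1) by auto
    qed
    then show "disjoint_family ?A" unfolding disjoint_family_on_def by blast
  qed
  moreover have "prob (\<Union>l. ?A l) = 1"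
  proof -
    have "AE \<omega> in N. \<omega> \<in> (\<Union>l. ?A l)"
      using AE_barriers
    proof (rule AE_mp, intro AE_I2 impI)
      fix \<omega> assume B: "\<forall>m. (\<exists>c\<le>m. barrier \<omega> c) \<and> (\<exists>c\<ge>m. barrier \<omega> c)"
      obtain c where c: "c \<le> 0" "barrier \<omega> c" using B by blast
      obtain d where d: "1 \<le> d" "barrier \<omega> d" using B by blast
      have "\<exists>l. gap0_eq \<omega> (int l)"
        using c d by (intro ex_gap0_eq[of c \<omega> d] barrier_in_H1) auto
      then show "\<omega> \<in> (\<Union>l. ?A l)" by blast
    qed
    then show ?thesis using A by (intro prob_eq_1[THEN iffD2]) auto
  qed
  ultimately have "(\<lambda>l. ?\<kappa> * law (Suc l) 1) sums 1"
    by (simp only: prob_gap0_eq)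
  moreover have "(\<lambda>l. ?\<kappa> * law (Suc l) 1) sums (?\<kappa> * (1 / (rh - rb)))"
    by (rule sums_mult[OF law_sums])
  ultimately have "1 = ?\<kappa> * (1 / (rh - rb))" by (rule sums_unique2)
  then show ?thesis using rb_less_rh by (simp add: field_simps)
qed

lemma prob_gap0_eq_law: "prob {\<omega>. gap0_eq \<omega> (int l)} = (rh - rb) * law (Suc l) 1"
  by (simp only: prob_gap0_eq prob_consecutive_H1_0_1)

end

theorem mainTheorem9:
  fixes p rb rh :: real and l0 :: nat
  assumes "0 < rb" "rb < rh" "rb + rh \<le> 1" "0 \<le> p" "p \<le> 1"
  shows "measure (golf_space p rb rh)
           {\<omega> \<in> space (golf_space p rb rh). gap0_eq \<omega> (int l0)}
         = (rh - rb) * (\<Sum>b0 \<in> {b0. 2 * b0 \<le> l0}.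
              (real l0 + 1) / (real b0 + 1)
              * (fact l0 / (fact b0 * fact b0 * fact (l0 - 2 * b0)))
              * rb ^ b0 * rh ^ (b0 + 1) * (1 - rb - rh) ^ (l0 - 2 * b0))"
proof -
  interpret golf p rb rh using assms by unfold_locales
  \<comment> \<open>Taking \<open>l0 + 1\<close> out of \<open>fact (Suc l0)\<close> and
    \<open>b + 1\<close> out of \<open>fact (b + 1)\<close> turns the coefficient for
    \<open>l0 + 1\<close> sites into the one for \<open>l0\<close> sites of the claim.\<close>
  have "trinomial rb rh rn b (b + 1) (l0 - 2 * b) = (real l0 + 1) / (real b + 1)
      * (fact l0 / (fact b * fact b * fact (l0 - 2 * b))) * rb ^ b * rh ^ (b + 1) * (1 - rb - rh) ^ (l0 - 2 * b)"
    if "2 * b \<le> l0" for b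
  proof -
    have "b + (b + 1) + (l0 - 2 * b) = Suc l0" using that by simp
    moreover have "fact (Suc l0) = (real l0 + 1) * fact l0" "fact (b + 1) = (real b + 1) * fact b"
      by (simp_all add: algebra_simps)
    ultimately show ?thesis by (simp only: trinomial_def rn_def) (simp add: field_simps)
  qed
  then have "law (Suc l0) 1 = (\<Sum>b0 \<in> {b0. 2 * b0 \<le> l0}.
      (real l0 + 1) / (real b0 + 1) * (fact l0 / (fact b0 * fact b0 * fact (l0 - 2 * b0)))
      * rb ^ b0 * rh ^ (b0 + 1) * (1 - rb - rh) ^ (l0 - 2 * b0))"
    unfolding law_1_eq by (intro sum.cong) auto
  then show ?thesis
    using prob_gap0_eq_law[of l0] by (simp add: golf_space_eq)
qed

end
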